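(* Let $n\ge1$ and let $\alpha\in\mathbb{R}$ be such that $\alpha^n,\alpha^{n-1},\dots,\alpha,1$ are linearly independent over $\mathbb{Q}$. Let $B_1,B_2,\dots$ be the Minkowski chain of $(\alpha^n,\alpha^{n-1},\dots,\alpha)\in\mathbb{R}^n$. Then $\alpha$ is algebraic of degree $n+1$ over $\mathbb{Q}$ if and only if the sequence of $n$-tuples $\{B_k(\alpha^n,\alpha^{n-1},\dots,\alpha)\}_{k\ge1}$ takes only finitely many distinct values.
   Context: Minkowski chain: Let $n\ge1$, $\ell=n+1$, $(\alpha_1,\dots,\alpha_n)\in\mathbb{R}^n$ with $\alpha_1,\dots,\alpha_n,1$ linearly independent over $\mathbb{Q}$. For $r=(r_1,\dots,r_\ell)\in\mathbb{Z}^\ell$ put $\xi(r)=r_1\alpha_1+\cdots+r_n\alpha_n+r_\ell$. For a real matrix or vector, $\|\cdot\|_\infty$ is the maximum absolute value of its entries. For $m\in\mathbb{Z}^+$, $A_m$ is the nonsingular integral $\ell\times\ell$ matrix with rows $w_1,\dots,w_\ell$ chosen successively: $w_i$ is the vector $w\in\mathbb{Z}^\ell$ with $\|w\|_\infty\le m$, linearly independent of $w_1,\dots,w_{i-1}$, minimizing $|\xi(w)|$, normalized so that its first nonzero entry is positive (unique by the linear independence hypothesis). The Minkowski chain $B_1,B_2,\dots$ is the sequence of distinct matrices among $A_1,A_2,A_3,\dots$ in order of appearance ($B_1=A_1$). An $\ell\times\ell$ matrix $B=(b_{i,j})$ acts on $x=(x_1,\dots,x_n)$ by $$B(x)=\Big(\tfrac{\sum_{j=1}^n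 b_{i,j}x_j+b_{i,\ell}}{\sum_{j=1}^n b_{\ell,j}x_j+b_{\ell,\ell}}\Big)_{i=1,\dots,n}.$$ *)

theory Defs
  imports Complex_Main "HOL-Computational_Algebra.Polynomial" "HOL-Library.Infinite_Set"
begin

(* Vectors in Z^l / R^n are lists; index i (0-based) corresponds to index i+1 in the paper.
   al = [alpha_1,...,alpha_n], so l = length al + 1; the last entry of an
   integer vector r (index n) is r_l. *)

definition xi :: "real list \<Rightarrow> int list \<Rightarrow> real" where
  "xi al r = (\<Sum>j<length al. of_int (r ! j) * al ! j) + of_int (r ! length al)"

definition lin_indep_Q :: "real list \<Rightarrow> bool" where
  "lin_indep_Q al \<longleftrightarrow>
     (\<forall>q :: nat \<Rightarrow> rat.
        (\<Sum>j<length al. of_rat (q j) * al ! j) + of_rat (q (length al)) = 0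
        \<longrightarrow> (\<forall>j\<le>length al. q j = 0))"

definition sup_norm :: "int list \<Rightarrow> int" where
  "sup_norm w = Max (insert 0 (abs ` set w))"

definition in_span_Q :: "nat \<Rightarrow> int list list \<Rightarrow> int list \<Rightarrow> bool" where
  "in_span_Q l ws w \<longleftrightarrow>
     (\<exists>c :: nat \<Rightarrow> rat. \<forall>j<l. of_int (w ! j) = (\<Sum>i<length ws. c i * of_int (ws ! i ! j)))"

definition first_nz_pos :: "int list \<Rightarrow> bool" where
  "first_nz_pos w \<longleftrightarrow> (\<exists>k<length w. (\<forall>j<k. w ! j = 0) \<and> w ! k > 0)"

definition cand :: "real list \<Rightarrow> nat \<Rightarrow> int list list \<Rightarrow> int list set" where
  "cand al m ws = {w. length w = length al + 1 \<and> sup_norm w \<le> int m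
                      \<and> \<not> in_span_Q (length al + 1) ws w}"

definition next_row :: "real list \<Rightarrow> nat \<Rightarrow> int list list \<Rightarrow> int list" where
  "next_row al m ws = (THE w. w \<in> cand al m ws \<and> first_nz_pos w \<and>
       (\<forall>w'\<in>cand al m ws. \<bar>xi al w\<bar> \<le> \<bar>xi al w'\<bar>))"

fun rows :: "real list \<Rightarrow> nat \<Rightarrow> nat \<Rightarrow> int list list" where
  "rows al m 0 = []"
| "rows al m (Suc i) = rows al m i @ [next_row al m (rows al m i)]"

definition A_mat :: "real list \<Rightarrow> nat \<Rightarrow> int list list" where
  "A_mat al m = rows al m (length al + 1)"

definition new_idx :: "real list \<Rightarrow> nat set" where
  "new_idx al = {m. 1 \<le> m \<and> (\<forall>j. 1 \<le> j \<and> j < m \<longrightarrow> A_mat al j \<noteq> A_mat al m)}"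

(* minkowski_chain al k = B_(k+1), k = 0,1,2,... *)
definition minkowski_chain :: "real list \<Rightarrow> nat \<Rightarrow> int list list" where
  "minkowski_chain al k = A_mat al (enumerate (new_idx al) k)"

definition act :: "int list list \<Rightarrow> real list \<Rightarrow> real list" where
  "act B x = map (\<lambda>i. ((\<Sum>j<length x. of_int (B ! i ! j) * x ! j) + of_int (B ! i ! length x))
                      / ((\<Sum>j<length x. of_int (B ! length x ! j) * x ! j) + of_int (B ! length x ! length x)))
                 [0..<length x]"

definition alg_degree_Q :: "real \<Rightarrow> nat \<Rightarrow> bool" where
  "alg_degree_Q a d \<longleftrightarrow>
     (\<exists>p :: rat poly. p \<noteq> 0 \<and> poly (map_poly of_rat p) a = 0 \<and> degree p = d \<and>
        (\<forall>q :: rat poly. q \<noteq> 0 \<and> poly (map_poly of_rat q) a = 0 \<longrightarrow> degree p \<le> degree q))"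

definition pow_vec :: "nat \<Rightarrow> real \<Rightarrow> real list" where
  "pow_vec n a = map (\<lambda>i. a ^ (n - i)) [0..<n]"

end

theory Submission
  imports "Jordan_Normal_Form.Determinant" Defs
begin

text \<open>
  If \<open>\<alpha>\<close> has degree \<open>n + 1\<close>, multiplication by an integral multiple \<open>D * \<alpha>\<close> acts on coordinate
  vectors by an integer matrix. A vector \<open>w\<close> and its images under the powers of \<open>D * \<alpha>\<close> form an
  integer matrix, whose determinant is essentially the norm of \<open>xi w\<close>. Applied to a vector supplied
  by the pigeonhole principle, this gives \<open>n + 1\<close> independent vectors of size \<open>O(m)\<close> with values
  \<open>O(m^-n)\<close>, so all rows of \<open>A_m\<close> satisfy these bounds. Applied to the last row of \<open>A_m\<close>, Cramer's rule
  expresses the quotients of the values of the rows by integer determinants; replacing a column by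
  the values of the linear form shows that these are bounded. Hence there are only finitely many quotients.

  Conversely, suppose that \<open>1, \<alpha>, \<dots>, \<alpha>^(n+1)\<close> are independent and that two members of the chain have
  the same image. Then the vector of powers is an eigenvector of \<open>adj(A') A\<close>, which forces this matrix
  to be scalar, so \<open>A\<close> and \<open>A'\<close> are proportional. Minimality makes first rows primitive, hence \<open>A = A'\<close>:
  the images of the infinitely many members of the chain are pairwise distinct.
\<close>

subsection \<open>The linear form\<close>

lemma sup_norm_le_iff: "0 \<le> m \<Longrightarrow> sup_norm w \<le> m \<longleftrightarrow> (\<forall>x\<in>set w. \<bar>x\<bar> \<le> m)"
  unfolding sup_norm_def by (subst Max_le_iff) auto

lemma sup_norm_nth_le:
  assumes "sup_norm w \<le> int m" "j < length w"
  shows "\<bar>w ! j\<bar> \<le> int m"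
  using assms by (simp add: sup_norm_le_iff)

lemma sup_norm_leI: "(\<And>j. j < length w \<Longrightarrow> \<bar>w ! j\<bar> \<le> int m) \<Longrightarrow> sup_norm w \<le> int m"
  by (auto simp: sup_norm_le_iff in_set_conv_nth)

lemma sup_norm_map_uminus: "sup_norm (map uminus w) = sup_norm w"
  unfolding sup_norm_def by (simp add: image_image)

text \<open>Appending 1 to \<open>al\<close> absorbs the constant term, so that the form becomes a
  single sum, to which linearity, Cramer's rule and exchanges of summation apply uniformly.\<close>

lemma xi_eq_sum: "xi al w = (\<Sum>j<Suc (length al). of_int (w ! j) * (al @ [1]) ! j)"
  unfolding xi_def by (simp add: nth_append)

lemma xi_diff:
  assumes "length w = Suc (length al)" "length w' = Suc (length al)"
  shows "xi al (map2 (-) w w') = xi al w - xi al w'"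
  using assms unfolding xi_eq_sum by (simp add: sum_subtractf[symmetric] left_diff_distrib)

lemma xi_map_mult:
  assumes "length w = Suc (length al)"
  shows "xi al (map ((*) k) w) = of_int k * xi al w"
  using assms unfolding xi_eq_sum by (simp add: sum_distrib_left distrib_left mult.assoc)

lemma xi_uminus:
  assumes "length w = Suc (length al)"
  shows "xi al (map uminus w) = - xi al w"
  using assms unfolding xi_eq_sum by (simp add: sum_negf)

lemma lin_indep_QD:
  fixes w :: "nat \<Rightarrow> int"
  assumes "lin_indep_Q al" "(\<Sum>j<Suc (length al). of_int (w j) * (al @ [1]) ! j) = 0" "j \<le> length al"
  shows "w j = 0"
  using assms(1)[unfolded lin_indep_Q_def, rule_format, of "\<lambda>j. of_int (w j)" j] assms(2,3)
  by (simp add: nth_append)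

lemma xi_eq_0D:
  assumes "lin_indep_Q al" "xi al w = 0" "j \<le> length al"
  shows "w ! j = 0"
  using lin_indep_QD[OF assms(1), of "\<lambda>j. w ! j" j] assms(2,3) by (simp add: xi_eq_sum)

lemma xi_inj:
  assumes "lin_indep_Q al" "length w = Suc (length al)" "length w' = Suc (length al)"
    and "xi al w = xi al w'"
  shows "w = w'"
proof (rule nth_equalityI)
  fix j assume "j < length w"
  then have "map2 (-) w w' ! j = 0"
    using assms by (intro xi_eq_0D[OF assms(1)]) (simp_all add: xi_diff)
  with \<open>j < length w\<close> assms show "w ! j = w' ! j" by simp
qed (use assms in simp)

subsection \<open>Matrices with given integer rows\<close>

text \<open>The rows are given by a function, so that exchanging row \<open>k\<close> for
  \<open>u\<close>, as in Cramer's rule, is just \<open>f(k := u)\<close>.\<close>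

definition int_mat :: "nat \<Rightarrow> (nat \<Rightarrow> int list) \<Rightarrow> int mat" where
  "int_mat l f = mat l l (\<lambda>(i, j). f i ! j)"

lemma int_mat_carrier [simp]: "int_mat l f \<in> carrier_mat l l"
  and int_mat_index [simp]: "i < l \<Longrightarrow> j < l \<Longrightarrow> int_mat l f $$ (i, j) = f i ! j"
  and int_mat_dim [simp]: "dim_row (int_mat l f) = l" "dim_col (int_mat l f) = l"
  by (auto simp: int_mat_def)

text \<open>The coefficients form a kernel vector of the transpose; over an integral domain it can
  be chosen with entries in the ring, so the relation between the rows is integral.\<close>

lemma det_int_mat_eq_0D:
  assumes "det (int_mat l f) = 0"
  obtains t :: "nat \<Rightarrow> int" and i where "i < l" "t i \<noteq> 0"
    and "\<And>j. j < l \<Longrightarrow> (\<Sum>i<l. t i * f i ! j) = 0"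
proof -
  have "det (transpose_mat (int_mat l f)) = 0"
    using assms by (subst det_transpose[of _ l]) simp_all
  then obtain v where v: "v \<in> carrier_vec l" "v \<noteq> 0\<^sub>v l"
    "transpose_mat (int_mat l f) *\<^sub>v v = 0\<^sub>v l"
    using det_0_iff_vec_prod_zero[of "transpose_mat (int_mat l f)" l] by auto
  obtain i where i: "i < l" "v $ i \<noteq> 0"
    using v(1,2) by (auto simp: vec_eq_iff)
  have "(\<Sum>i<l. v $ i * f i ! j) = 0" if "j < l" for j
  proof -
    have "(transpose_mat (int_mat l f) *\<^sub>v v) $ j = (\<Sum>i<l. v $ i * f i ! j)"
      using that v(1) by (auto simp: scalar_prod_def lessThan_atLeast0 mult.commute intro!: sum.cong)
    then show ?thesis using v(3) that by simp
  qed
  with i show ?thesis using that[of i "\<lambda>i. v $ i"] by blast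
qed

text \<open>The matrix factors over the rationals as \<open>C * W\<close>, where the rows of
  \<open>W\<close> are the spanning vectors padded by at least one zero row, so that
  \<open>W\<close> is singular.\<close>

lemma in_span_Q_imp_det_eq_0:
  assumes len: "length ws < l" and span: "\<And>i. i < l \<Longrightarrow> in_span_Q l ws (f i)"
  shows "det (int_mat l f) = 0"
proof -
  obtain c :: "nat \<Rightarrow> nat \<Rightarrow> rat" where c:
    "\<And>i j. i < l \<Longrightarrow> j < l \<Longrightarrow> of_int (f i ! j) = (\<Sum>k<length ws. c i k * of_int (ws ! k ! j))"
    using span unfolding in_span_Q_def by metis
  define C where "C = mat l l (\<lambda>(i, k). if k < length ws then c i k else 0)"
  define W :: "rat mat" where
    "W = mat l l (\<lambda>(k, j). if k < length ws then of_int (ws ! k ! j) else 0)"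
  have "map_mat of_int (int_mat l f) = C * W"
  proof (rule eq_matI)
    fix i j assume "i < dim_row (C * W)" "j < dim_col (C * W)"
    then have ij: "i < l" "j < l" by (simp_all add: C_def W_def)
    have "(C * W) $$ (i, j) = (\<Sum>k<l. if k < length ws then c i k * of_int (ws ! k ! j) else 0)"
      using ij by (auto simp: C_def W_def scalar_prod_def lessThan_atLeast0 intro!: sum.cong)
    also have "\<dots> = (\<Sum>k<length ws. c i k * of_int (ws ! k ! j))"
      using len by (intro sum.mono_neutral_cong_right) auto
    finally show "map_mat of_int (int_mat l f) $$ (i, j) = (C * W) $$ (i, j)"
      using c[OF ij] ij by simp
  qed (auto simp: C_def W_def)
  moreover have "det W = 0"
  proof -
    have W: "W \<in> carrier_mat l l" by (simp add: W_def)
    \<comment> \<open>Row \<open>length ws\<close> of \<open>W\<close> is the first of the zero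
      rows; this unit vector selects it and thus lies in the kernel of the transpose.\<close>
    have "unit_vec l (length ws) \<noteq> (0\<^sub>v l :: rat vec)"
      using len by (auto simp: vec_eq_iff intro!: exI[of _ "length ws"])
    moreover have "transpose_mat W *\<^sub>v unit_vec l (length ws) = 0\<^sub>v l"
      using len by (intro eq_vecI) (auto simp: W_def)
    ultimately have "det (transpose_mat W) = 0"
      using W by (subst det_0_iff_vec_prod_zero[of _ l]) (auto intro: exI[of _ "unit_vec l (length ws)"])
    then show ?thesis using det_transpose[OF W] by metis
  qed
  moreover have "det (C * W) = det C * det W"
    by (rule det_mult[of _ l]) (simp_all add: C_def W_def)
  ultimately have "det (map_mat of_int (int_mat l f) :: rat mat) = 0" by (metis mult_zero_right)
  then have "(of_int (det (int_mat l f)) :: rat) = 0" by (metis of_int_hom.hom_det)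
  then show ?thesis by (rule of_int_eq_0_iff[THEN iffD1])
qed

subsection \<open>The rows of the matrices\<close>

lemma finite_cand: "finite (cand al m ws)"
proof (rule finite_subset)
  show "cand al m ws \<subseteq> {w. set w \<subseteq> {-int m..int m} \<and> length w = Suc (length al)}"
    by (auto simp: cand_def sup_norm_le_iff abs_le_iff)
qed (rule finite_lists_length_eq, simp)

text \<open>The unit vectors fit into every box and form the identity matrix, so they cannot all lie
  in the span of at most \<open>length al\<close> vectors.\<close>

lemma cand_nonempty:
  assumes "1 \<le> m" "length ws \<le> length al"
  shows "cand al m ws \<noteq> {}"
proof
  assume empty: "cand al m ws = {}"
  define e where "e = (\<lambda>i. map (\<lambda>j. if i = j then 1 else 0 :: int) [0..<Suc (length al)])"
  have "in_span_Q (Suc (length al)) ws (e i)" for i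
  proof -
    have "sup_norm (e i) \<le> int m"
      using assms(1) by (intro sup_norm_leI) (auto simp: e_def simp del: upt_Suc)
    then show ?thesis using empty by (auto simp: cand_def e_def)
  qed
  then have "det (int_mat (Suc (length al)) e) = 0"
    using assms(2) by (intro in_span_Q_imp_det_eq_0[of ws]) auto
  moreover have "int_mat (Suc (length al)) e = 1\<^sub>m (Suc (length al))"
    by (rule eq_matI) (auto simp: e_def simp del: upt_Suc)
  ultimately show False by simp
qed

lemma in_span_Q_uminus:
  assumes "length w = l" "in_span_Q l ws (map uminus w)"
  shows "in_span_Q l ws w"
proof -
  obtain c where c: "\<forall>j<l. rat_of_int (map uminus w ! j) = (\<Sum>i<length ws. c i * of_int (ws ! i ! j))"
    using assms(2) by (auto simp: in_span_Q_def)
  show ?thesis unfolding in_span_Q_def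
  proof (intro exI[of _ "\<lambda>i. - c i"] allI impI)
    fix j assume "j < l"
    with c assms(1) have "- of_int (w ! j) = (\<Sum>i<length ws. c i * of_int (ws ! i ! j))" by simp
    then show "rat_of_int (w ! j) = (\<Sum>i<length ws. - c i * of_int (ws ! i ! j))"
      by (simp add: sum_negf)
  qed
qed

lemma cand_uminus: "w \<in> cand al m ws \<Longrightarrow> map uminus w \<in> cand al m ws"
  using in_span_Q_uminus by (auto simp: cand_def sup_norm_map_uminus)

lemma cand_nonzero:
  assumes "w \<in> cand al m ws"
  obtains j where "j < length w" "w ! j \<noteq> 0"
proof -
  have "\<exists>j<length w. w ! j \<noteq> 0"
  proof (rule ccontr)
    assume "\<not> ?thesis"
    then have "in_span_Q (length al + 1) ws w"
      using assms by (auto simp: in_span_Q_def cand_def intro!: exI[of _ "\<lambda>_. 0"])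
    then show False using assms by (simp add: cand_def)
  qed
  then show ?thesis using that by blast
qed

lemma first_nz_pos_or_uminus:
  assumes "j < length w" "w ! j \<noteq> 0"
  shows "first_nz_pos w \<or> first_nz_pos (map uminus w)"
proof -
  define k where "k = (LEAST k. k < length w \<and> w ! k \<noteq> 0)"
  have k: "k < length w" "w ! k \<noteq> 0"
    using LeastI[of "\<lambda>k. k < length w \<and> w ! k \<noteq> 0" j] assms by (auto simp: k_def)
  have "w ! i = 0" if "i < k" for i
    using not_less_Least[of i "\<lambda>k. k < length w \<and> w ! k \<noteq> 0"] that k by (auto simp: k_def)
  with k show ?thesis unfolding first_nz_pos_def
    by (cases "w ! k > 0") (auto intro!: exI[of _ k])
qed

lemma first_nz_pos_not_uminus: "first_nz_pos w \<Longrightarrow> \<not> first_nz_pos (map uminus w)"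
proof
  assume "first_nz_pos w" "first_nz_pos (map uminus w)"
  then obtain i k where i: "i < length w" "\<forall>j<i. w ! j = 0" "w ! i > 0"
    and k: "k < length w" "\<forall>j<k. w ! j = 0" "w ! k < 0"
    unfolding first_nz_pos_def by fastforce
  then show False by (cases i k rule: linorder_cases) auto
qed

text \<open>This justifies the definite description in \<open>next_row\<close>. A minimizer exists
  because the box is finite; two minimizers have values equal up to sign, hence agree up to sign by
  \<open>xi_inj\<close>, and the normalization selects one of them.\<close>

lemma next_row_props:
  assumes "lin_indep_Q al" "1 \<le> m" "length ws \<le> length al"
  shows next_row_in_cand: "next_row al m ws \<in> cand al m ws"
    and next_row_first_nz_pos: "first_nz_pos (next_row al m ws)"
    and next_row_le: "w \<in> cand al m ws \<Longrightarrow> \<bar>xi al (next_row al m ws)\<bar> \<le> \<bar>xi al w\<bar>"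
proof -
  let ?P = "\<lambda>w. w \<in> cand al m ws \<and> first_nz_pos w \<and> (\<forall>w'\<in>cand al m ws. \<bar>xi al w\<bar> \<le> \<bar>xi al w'\<bar>)"
  define w0 where "w0 = arg_min_on (\<lambda>w. \<bar>xi al w\<bar>) (cand al m ws)"
  have w0: "w0 \<in> cand al m ws"
    using cand_nonempty[OF assms(2,3)] by (auto simp: w0_def finite_cand intro: arg_min_if_finite)
  have w0_le: "\<bar>xi al w0\<bar> \<le> \<bar>xi al w'\<bar>" if "w' \<in> cand al m ws" for w'
    unfolding w0_def using that by (intro arg_min_least finite_cand) auto
  have len: "length w = Suc (length al)" if "w \<in> cand al m ws" for w
    using that by (simp add: cand_def)
  obtain j where "j < length w0" "w0 ! j \<noteq> 0" using cand_nonzero[OF w0] .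
  then have "first_nz_pos w0 \<or> first_nz_pos (map uminus w0)"
    by (rule first_nz_pos_or_uminus)
  moreover have "\<bar>xi al (map uminus w0)\<bar> = \<bar>xi al w0\<bar>"
    by (simp add: xi_uminus[OF len[OF w0]])
  ultimately have "?P w0 \<or> ?P (map uminus w0)"
    using w0 w0_le cand_uminus[OF w0] by metis
  then have ex: "\<exists>w. ?P w" by blast
  have "w = w'" if P: "?P w" "?P w'" for w w'
  proof -
    have lens: "length w = Suc (length al)" "length w' = Suc (length al)"
      using P len by blast+
    have "\<bar>xi al w\<bar> = \<bar>xi al w'\<bar>" using P by (meson order_antisym)
    then have "xi al w = xi al w' \<or> xi al w = xi al (map uminus w')"
      unfolding xi_uminus[OF lens(2)] abs_eq_iff .
    then have "w = w' \<or> w = map uminus w'"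
      using xi_inj[OF assms(1) lens] xi_inj[OF assms(1) lens(1), of "map uminus w'"] lens(2)
      by (metis length_map)
    then show ?thesis using P first_nz_pos_not_uminus by blast
  qed
  with ex have "\<exists>!w. ?P w" by blast
  then have "?P (next_row al m ws)"
    unfolding next_row_def by (rule theI'[of ?P])
  then show "next_row al m ws \<in> cand al m ws" "first_nz_pos (next_row al m ws)"
    "w \<in> cand al m ws \<Longrightarrow> \<bar>xi al (next_row al m ws)\<bar> \<le> \<bar>xi al w\<bar>" by auto
qed

lemma length_rows [simp]: "length (Defs.rows al m i) = i"
  by (induction i) auto

lemma nth_rows: "i < k \<Longrightarrow> Defs.rows al m k ! i = next_row al m (Defs.rows al m i)"
  by (induction k) (auto simp: nth_append less_Suc_eq)

lemma length_A_mat [simp]: "length (A_mat al m) = Suc (length al)"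
  by (simp add: A_mat_def del: rows.simps)

lemma A_mat_nth: "i \<le> length al \<Longrightarrow> A_mat al m ! i = next_row al m (Defs.rows al m i)"
  by (simp add: A_mat_def nth_rows del: rows.simps)

lemma A_mat_nth_props:
  assumes "lin_indep_Q al" "1 \<le> m" "i \<le> length al"
  shows A_mat_nth_in_cand: "A_mat al m ! i \<in> cand al m (Defs.rows al m i)"
    and A_mat_first_nz_pos: "first_nz_pos (A_mat al m ! i)"
    and A_mat_nth_le: "w \<in> cand al m (Defs.rows al m i) \<Longrightarrow> \<bar>xi al (A_mat al m ! i)\<bar> \<le> \<bar>xi al w\<bar>"
    and length_A_mat_nth: "length (A_mat al m ! i) = Suc (length al)"
    and sup_norm_A_mat_nth: "sup_norm (A_mat al m ! i) \<le> int m"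
proof -
  show 1: "A_mat al m ! i \<in> cand al m (Defs.rows al m i)"
    using assms by (simp add: A_mat_nth next_row_in_cand)
  then show "length (A_mat al m ! i) = Suc (length al)" "sup_norm (A_mat al m ! i) \<le> int m"
    by (simp_all add: cand_def)
qed (use assms in \<open>simp_all add: A_mat_nth next_row_first_nz_pos next_row_le\<close>)

lemma xi_A_mat_nth_nonzero:
  assumes "lin_indep_Q al" "1 \<le> m" "i \<le> length al"
  shows "xi al (A_mat al m ! i) \<noteq> 0"
proof
  assume "xi al (A_mat al m ! i) = 0"
  then have "A_mat al m ! i ! j = 0" if "j \<le> length al" for j
    using xi_eq_0D[OF assms(1)] that by blast
  moreover obtain j where "j < length (A_mat al m ! i)" "A_mat al m ! i ! j \<noteq> 0"
    using cand_nonzero[OF A_mat_nth_in_cand[OF assms]] .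
  ultimately show False using length_A_mat_nth[OF assms] by simp
qed

text \<open>In a nontrivial relation between the rows, the last row with a nonzero coefficient
  (index \<open>k\<close>) would be a rational combination of its predecessors, against the way it
  was chosen.\<close>

lemma det_A_mat_nonzero:
  assumes "lin_indep_Q al" "1 \<le> m"
  shows "det (int_mat (Suc (length al)) ((!) (A_mat al m))) \<noteq> 0"
proof
  let ?l = "Suc (length al)"
  assume "det (int_mat ?l ((!) (A_mat al m))) = 0"
  then obtain t i0 where t: "i0 < ?l" "t i0 \<noteq> 0"
    "\<And>j. j < ?l \<Longrightarrow> (\<Sum>i<?l. t i * A_mat al m ! i ! j) = 0"
    by (rule det_int_mat_eq_0D) blast
  define k where "k = Max {i. i < ?l \<and> t i \<noteq> 0}"
  have k: "k < ?l" "t k \<noteq> 0"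
    using Max_in[of "{i. i < ?l \<and> t i \<noteq> 0}"] t(1,2) unfolding k_def by fastforce+
  have above: "t i = 0" if "k < i" "i < ?l" for i
    using Max_ge[of "{i. i < ?l \<and> t i \<noteq> 0}" i] that unfolding k_def by fastforce
  have "in_span_Q ?l (Defs.rows al m k) (A_mat al m ! k)"
    unfolding in_span_Q_def
  proof (intro exI[of _ "\<lambda>i. - of_int (t i) / of_int (t k)"] allI impI)
    fix j assume "j < ?l"
    have "(\<Sum>i<?l. t i * A_mat al m ! i ! j) = (\<Sum>i<Suc k. t i * A_mat al m ! i ! j)"
      using k above by (intro sum.mono_neutral_right) auto
    then have "t k * A_mat al m ! k ! j = - (\<Sum>i<k. t i * A_mat al m ! i ! j)"
      using t(3)[OF \<open>j < ?l\<close>] by simp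
    then have "of_int (t k * A_mat al m ! k ! j) = (of_int (- (\<Sum>i<k. t i * A_mat al m ! i ! j)) :: rat)"
      by (rule arg_cong)
    then have eq: "of_int (t k) * of_int (A_mat al m ! k ! j)
        = - (\<Sum>i<k. of_int (t i) * (of_int (A_mat al m ! i ! j) :: rat))"
      by simp
    have "(of_int (A_mat al m ! k ! j) :: rat)
        = - (\<Sum>i<k. of_int (t i) * of_int (A_mat al m ! i ! j)) / of_int (t k)"
      using k eq by (simp add: field_simps)
    also have "\<dots> = (\<Sum>i<k. - of_int (t i) / of_int (t k) * of_int (A_mat al m ! i ! j))"
      by (simp add: sum_divide_distrib sum_negf)
    also have "\<dots> = (\<Sum>i<length (Defs.rows al m k).
        - of_int (t i) / of_int (t k) * of_int (Defs.rows al m k ! i ! j))"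
      using k by (intro sum.cong) (auto simp: nth_rows A_mat_nth)
    finally show "rat_of_int (A_mat al m ! k ! j) = (\<Sum>i<length (Defs.rows al m k).
        - of_int (t i) / of_int (t k) * of_int (Defs.rows al m k ! i ! j))" .
  qed
  then show False using A_mat_nth_in_cand[OF assms, of k] k by (simp add: cand_def)
qed

subsection \<open>Short vectors with small values, and the chain\<close>

lemma xi_le_sup_norm:
  assumes "length w = Suc (length al)" "sup_norm w \<le> int m"
  shows "\<bar>xi al w\<bar> \<le> (\<Sum>j<Suc (length al). \<bar>(al @ [1]) ! j\<bar>) * real m"
proof -
  have "\<bar>xi al w\<bar> \<le> (\<Sum>j<Suc (length al). \<bar>of_int (w ! j) * (al @ [1]) ! j\<bar>)"
    unfolding xi_eq_sum by (rule sum_abs)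
  also have "\<dots> \<le> (\<Sum>j<Suc (length al). \<bar>(al @ [1]) ! j\<bar> * real m)"
  proof (rule sum_mono)
    fix j assume "j \<in> {..<Suc (length al)}"
    then have "\<bar>w ! j\<bar> \<le> int m" using assms by (intro sup_norm_nth_le) simp_all
    then have "real_of_int \<bar>w ! j\<bar> \<le> real m" by linarith
    then show "\<bar>of_int (w ! j) * (al @ [1]) ! j\<bar> \<le> \<bar>(al @ [1]) ! j\<bar> * real m"
      by (simp add: abs_mult mult.commute mult_right_mono)
  qed
  finally show ?thesis by (simp only: sum_distrib_right)
qed

text \<open>Dirichlet's pigeonhole argument: there are \<open>(m + 1) ^ l\<close> vectors with
  entries between 0 and \<open>m\<close>, where \<open>l = Suc (length al)\<close>, but only
  \<open>m ^ l\<close> intervals for their values. The difference of two vectors in the same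
  interval is the one sought.\<close>

lemma ex_small_xi:
  obtains K where "K > 0" and "\<And>m. 1 \<le> m \<Longrightarrow> \<exists>w. length w = Suc (length al) \<and> sup_norm w \<le> int m \<and>
    (\<exists>j\<le>length al. w ! j \<noteq> 0) \<and> \<bar>xi al w\<bar> * real m ^ length al \<le> K"
proof -
  define S where "S = (\<Sum>j<Suc (length al). \<bar>(al @ [1]) ! j\<bar>)"
  have "S \<ge> 0" unfolding S_def by (rule sum_nonneg) simp
  have "\<exists>w. length w = Suc (length al) \<and> sup_norm w \<le> int m \<and>
    (\<exists>j\<le>length al. w ! j \<noteq> 0) \<and> \<bar>xi al w\<bar> * real m ^ length al \<le> 2 * S + 1" if "1 \<le> m" for m
  proof -
    let ?L = "Suc (length al)"
    define X where "X = {w. set w \<subseteq> {0..int m} \<and> length w = ?L}"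
    \<comment> \<open>The values lie between \<open>- S * m\<close> and \<open>S * m\<close>. They
      are shifted to be nonnegative and sorted into intervals of length
      \<open>(2 * S + 1) / m ^ length al\<close>; the summand 1 keeps the index strictly below
      \<open>m ^ ?L\<close> and the divisor positive.\<close>
    define h where "h = (\<lambda>w. \<lfloor>(xi al w + S * m) * real m ^ length al / (2 * S + 1)\<rfloor>)"
    have X: "length w = ?L" "sup_norm w \<le> int m" if "w \<in> X" for w
      using that by (auto simp: X_def sup_norm_le_iff subset_iff)
    have "h ` X \<subseteq> {0..<int (m ^ ?L)}"
    proof
      fix y assume "y \<in> h ` X"
      then obtain w where w: "w \<in> X" "y = h w" by blast
      have b: "\<bar>xi al w\<bar> \<le> S * m"
        unfolding S_def using X[OF w(1)] by (rule xi_le_sup_norm)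
      have "(xi al w + S * m) * real m ^ length al \<le> (2 * S * m) * real m ^ length al"
        using b by (intro mult_right_mono) auto
      also have "\<dots> < (2 * S + 1) * real (m ^ ?L)"
        using \<open>1 \<le> m\<close> by (simp add: algebra_simps)
      finally have "(xi al w + S * m) * real m ^ length al / (2 * S + 1) < real (m ^ ?L)"
        using \<open>S \<ge> 0\<close> by (simp add: field_simps)
      moreover have "0 \<le> (xi al w + S * m) * real m ^ length al / (2 * S + 1)"
        using b \<open>S \<ge> 0\<close> by (intro divide_nonneg_nonneg mult_nonneg_nonneg) auto
      ultimately show "y \<in> {0..<int (m ^ ?L)}"
        unfolding w(2) h_def by (simp add: floor_less_iff)
    qed
    then have "card (h ` X) \<le> m ^ ?L"
      using card_mono[of "{0..<int (m ^ ?L)}"] by (simp del: power_Suc of_nat_power)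
    also have "\<dots> < (m + 1) ^ ?L" by (rule power_strict_mono) auto
    also have "\<dots> = card X" unfolding X_def by (subst card_lists_length_eq) (simp_all add: nat_add_distrib)
    finally have "\<not> inj_on h X" by (rule pigeonhole)
    then obtain w w' where w: "w \<in> X" "w' \<in> X" "w \<noteq> w'" "h w = h w'"
      by (auto simp: inj_on_def)
    define u where "u = map2 (-) w w'"
    have nth: "u ! j = w ! j - w' ! j" if "j < ?L" for j
      using that X(1)[OF w(1)] X(1)[OF w(2)] by (simp add: u_def)
    have len: "length u = ?L" using X(1)[OF w(1)] X(1)[OF w(2)] by (simp add: u_def)
    have "sup_norm u \<le> int m"
    proof (rule sup_norm_leI)
      fix j assume "j < length u"
      then have "w ! j \<in> {0..int m}" "w' ! j \<in> {0..int m}"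
        using w(1,2) len by (auto simp: X_def subset_iff)
      with nth \<open>j < length u\<close> len show "\<bar>u ! j\<bar> \<le> int m" by auto
    qed
    moreover have "\<exists>j\<le>length al. u ! j \<noteq> 0"
    proof (rule ccontr)
      assume "\<not> ?thesis"
      then have "w = w'" using nth X(1)[OF w(1)] X(1)[OF w(2)]
        by (intro nth_equalityI) auto
      with w(3) show False by simp
    qed
    moreover have "\<bar>xi al u\<bar> * real m ^ length al \<le> 2 * S + 1"
    proof -
      have "\<bar>(xi al w + S * m) * real m ^ length al / (2 * S + 1)
          - (xi al w' + S * m) * real m ^ length al / (2 * S + 1)\<bar> < 1"
        using w(4) unfolding h_def by linarith
      also have "(xi al w + S * m) * real m ^ length al / (2 * S + 1)
          - (xi al w' + S * m) * real m ^ length al / (2 * S + 1)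
          = xi al u * real m ^ length al / (2 * S + 1)"
        unfolding u_def xi_diff[OF X(1)[OF w(1)] X(1)[OF w(2)]]
        by (simp add: diff_divide_distrib[symmetric] algebra_simps)
      finally show ?thesis using \<open>S \<ge> 0\<close> by (simp add: abs_mult field_simps)
    qed
    ultimately show ?thesis using len by blast
  qed
  with \<open>S \<ge> 0\<close> show ?thesis using that[of "2 * S + 1"] by simp
qed

lemma in_cand_Nil:
  assumes "length w = Suc (length al)" "sup_norm w \<le> int m" "j \<le> length al" "w ! j \<noteq> 0"
  shows "w \<in> cand al m []"
  using assms by (auto simp: cand_def in_span_Q_def intro!: exI[of _ j])

lemma A_mat_0_le:
  assumes "lin_indep_Q al" "1 \<le> m" "w \<in> cand al m []"
  shows "\<bar>xi al (A_mat al m ! 0)\<bar> \<le> \<bar>xi al w\<bar>"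
  using A_mat_nth_le[OF assms(1,2), of 0 w] assms(3) by simp

text \<open>Finitely many matrices would leave a positive lower bound \<open>d\<close> for the
  values of the first rows, whereas the vectors from the pigeonhole principle push these values to
  0. For this decay the exponent \<open>length al\<close> must be positive.\<close>

lemma infinite_A_mat:
  assumes "lin_indep_Q al" "length al \<ge> 1"
  shows "infinite (A_mat al ` {1..})"
proof
  let ?f = "\<lambda>A. \<bar>xi al (A ! 0)\<bar>"
  assume fin: "finite (A_mat al ` {1..})"
  define d where "d = Min (?f ` A_mat al ` {1..})"
  have "d \<in> ?f ` A_mat al ` {1..}" unfolding d_def using fin by (intro Min_in) auto
  then have "d > 0" using xi_A_mat_nth_nonzero[OF assms(1), of _ 0] by auto
  have d_le: "d \<le> ?f (A_mat al m)" if "1 \<le> m" for m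
    unfolding d_def using fin that by (intro Min_le) auto
  obtain K where K: "K > 0" "\<And>m. 1 \<le> m \<Longrightarrow> \<exists>w. length w = Suc (length al) \<and> sup_norm w \<le> int m \<and>
    (\<exists>j\<le>length al. w ! j \<noteq> 0) \<and> \<bar>xi al w\<bar> * real m ^ length al \<le> K"
    using ex_small_xi[of al] by blast
  obtain m where m: "K / d < real m" using reals_Archimedean2 by blast
  then have "real m > 0" using K(1) \<open>d > 0\<close> by (smt (verit) divide_pos_pos)
  then have "1 \<le> m" by simp
  obtain w j where w: "length w = Suc (length al)" "sup_norm w \<le> int m" "j \<le> length al" "w ! j \<noteq> 0"
    "\<bar>xi al w\<bar> * real m ^ length al \<le> K" using K(2)[OF \<open>1 \<le> m\<close>] by blast
  have "d \<le> \<bar>xi al w\<bar>"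
    using d_le[OF \<open>1 \<le> m\<close>] A_mat_0_le[OF assms(1) \<open>1 \<le> m\<close> in_cand_Nil[OF w(1-4)]] by linarith
  moreover have "real m ^ 1 \<le> real m ^ length al"
    using assms(2) \<open>1 \<le> m\<close> by (intro power_increasing) simp_all
  ultimately have "d * real m \<le> \<bar>xi al w\<bar> * real m ^ length al"
    using \<open>d > 0\<close> by (intro mult_mono) auto
  then show False using w(5) m \<open>d > 0\<close> by (simp add: field_simps)
qed

lemma A_mat_new_idx:
  assumes "1 \<le> m"
  obtains k where "k \<in> new_idx al" "A_mat al k = A_mat al m"
proof -
  define k where "k = (LEAST k. 1 \<le> k \<and> A_mat al k = A_mat al m)"
  have k: "1 \<le> k \<and> A_mat al k = A_mat al m"
    unfolding k_def by (rule LeastI[of _ m]) (use assms in simp)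
  have "\<not> (1 \<le> j \<and> A_mat al j = A_mat al m)" if "j < k" for j
    using that unfolding k_def by (rule not_less_Least)
  with k have "k \<in> new_idx al" unfolding new_idx_def by simp
  with k that show ?thesis by blast
qed

lemma inj_on_A_mat_new_idx: "inj_on (A_mat al) (new_idx al)"
proof (rule inj_onI)
  fix j k assume "j \<in> new_idx al" "k \<in> new_idx al" "A_mat al j = A_mat al k"
  then show "j = k" by (cases j k rule: linorder_cases) (auto simp: new_idx_def)
qed

lemma infinite_new_idx:
  assumes "lin_indep_Q al" "length al \<ge> 1"
  shows "infinite (new_idx al)"
proof
  assume "finite (new_idx al)"
  moreover have "A_mat al ` {1..} \<subseteq> A_mat al ` new_idx al"
  proof
    fix A assume "A \<in> A_mat al ` {1..}"
    then obtain m where m: "1 \<le> m" "A = A_mat al m" by auto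
    obtain k where "k \<in> new_idx al" "A_mat al k = A_mat al m" using A_mat_new_idx[OF m(1)] .
    then show "A \<in> A_mat al ` new_idx al" unfolding m(2) by (metis imageI)
  qed
  ultimately show False using infinite_A_mat[OF assms] finite_subset by blast
qed

text \<open>Since the set of new indices is infinite, \<open>enumerate\<close> runs through it
  strictly increasingly, and distinct new indices carry distinct matrices.\<close>

lemma inj_minkowski_chain:
  assumes "lin_indep_Q al" "length al \<ge> 1"
  shows "inj (minkowski_chain al)"
proof -
  note inf = infinite_new_idx[OF assms]
  have "inj (enumerate (new_idx al))"
    by (rule strict_mono_imp_inj_on[OF strict_mono_enumerate[OF inf]])
  moreover have "range (enumerate (new_idx al)) \<subseteq> new_idx al"
    using enumerate_in_set[OF inf] by blast
  ultimately have "inj (A_mat al \<circ> enumerate (new_idx al))"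
    by (intro comp_inj_on inj_on_subset[OF inj_on_A_mat_new_idx])
  then show ?thesis by (simp add: minkowski_chain_def[abs_def] comp_def)
qed

lemma minkowski_chain_eq_A_mat:
  assumes "lin_indep_Q al" "length al \<ge> 1"
  obtains m where "1 \<le> m" "minkowski_chain al k = A_mat al m"
proof
  show "1 \<le> enumerate (new_idx al) k"
    using enumerate_in_set[OF infinite_new_idx[OF assms], of k] by (auto simp: new_idx_def)
qed (simp add: minkowski_chain_def)

section \<open>Primitive first rows and proportional matrices\<close>

text \<open>Dividing the first row by a common divisor \<open>k\<close> of its entries keeps it in
  the box and divides its value by \<open>k\<close>, so minimality leaves only \<open>k\<close> = 1
  or -1.\<close>

lemma A_mat_0_primitive:
  assumes "lin_indep_Q al" "1 \<le> m"
    and dvd: "\<And>j. j \<le> length al \<Longrightarrow> k dvd A_mat al m ! 0 ! j"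
  shows "\<bar>k\<bar> = 1"
proof -
  let ?w = "A_mat al m ! 0"
  have len: "length ?w = Suc (length al)" and norm: "sup_norm ?w \<le> int m"
    using length_A_mat_nth sup_norm_A_mat_nth assms by auto
  define z where "z = map (\<lambda>x. x div k) ?w"
  have z: "?w ! j = k * z ! j" if "j \<le> length al" for j
    using dvd[OF that] len that by (simp add: z_def)
  have w: "?w = map ((*) k) z"
    by (rule nth_equalityI) (use len z in \<open>auto simp: z_def\<close>)
  have lenz: "length z = Suc (length al)" using len by (simp add: z_def)
  have "xi al ?w = of_int k * xi al z" using xi_map_mult[OF lenz] w by metis
  moreover have nz: "xi al ?w \<noteq> 0" by (rule xi_A_mat_nth_nonzero) (use assms in auto)
  ultimately have "k \<noteq> 0" "xi al z \<noteq> 0" by auto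
  have "\<exists>j\<le>length al. z ! j \<noteq> 0"
  proof (rule ccontr)
    assume "\<not> ?thesis"
    then have "xi al z = 0" by (simp add: xi_def)
    then show False using \<open>xi al z \<noteq> 0\<close> by simp
  qed
  then obtain j where j: "j \<le> length al" "z ! j \<noteq> 0" by blast
  have "sup_norm z \<le> int m"
  proof (rule sup_norm_leI)
    fix i assume "i < length z"
    then have "\<bar>k * z ! i\<bar> \<le> int m"
      using sup_norm_nth_le[OF norm, of i] z[of i] len lenz by simp
    moreover have "\<bar>z ! i\<bar> \<le> \<bar>k\<bar> * \<bar>z ! i\<bar>"
      using \<open>k \<noteq> 0\<close> mult_right_mono[of 1 "\<bar>k\<bar>" "\<bar>z ! i\<bar>"] by simp
    ultimately show "\<bar>z ! i\<bar> \<le> int m" by (simp add: abs_mult)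
  qed
  then have "\<bar>xi al ?w\<bar> \<le> \<bar>xi al z\<bar>"
    by (intro A_mat_0_le assms in_cand_Nil[OF lenz _ j])
  then have "\<bar>of_int k\<bar> * \<bar>xi al z\<bar> \<le> 1 * \<bar>xi al z\<bar>"
    using \<open>xi al ?w = _\<close> by (simp add: abs_mult)
  then have "\<bar>of_int k :: real\<bar> \<le> 1"
    by (rule mult_right_le_imp_le) (use \<open>xi al z \<noteq> 0\<close> in simp)
  then show ?thesis using \<open>k \<noteq> 0\<close> by linarith
qed

text \<open>With the factor in lowest terms, its numerator and denominator each divide a primitive
  first row and are therefore units. The remaining sign is decided by the normalization of the first
  rows.\<close>

lemma A_mat_proportional_imp_eq:
  assumes indep: "lin_indep_Q al" and m: "1 \<le> m" "1 \<le> m'" and "d \<noteq> 0"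
    and eq: "\<And>i j. i \<le> length al \<Longrightarrow> j \<le> length al \<Longrightarrow>
      d * A_mat al m ! i ! j = c * A_mat al m' ! i ! j"
  shows "A_mat al m = A_mat al m'"
proof -
  let ?w = "A_mat al m ! 0" and ?w' = "A_mat al m' ! 0"
  have len: "length (A_mat al k ! i) = Suc (length al)" if "1 \<le> k" "i \<le> length al" for k i
    using length_A_mat_nth[OF indep that] .
  define g where "g = gcd d c"
  obtain d1 c1 where dc: "d = d1 * g" "c = c1 * g" "coprime d1 c1"
    using gcd_coprime_exists[of d c] \<open>d \<noteq> 0\<close> unfolding g_def by auto
  have "g \<noteq> 0" using \<open>d \<noteq> 0\<close> by (simp add: g_def)
  have eq1: "d1 * A_mat al m ! i ! j = c1 * A_mat al m' ! i ! j" if "i \<le> length al" "j \<le> length al" for i j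
    using eq[OF that] \<open>g \<noteq> 0\<close> by (simp add: dc)
  have "\<bar>d1\<bar> = 1"
  proof (rule A_mat_0_primitive[OF indep m(2)])
    fix j assume "j \<le> length al"
    then have "d1 dvd c1 * ?w' ! j" using eq1[of 0 j] by (metis dvd_triv_left zero_le)
    then show "d1 dvd ?w' ! j" using dc(3) by (simp add: coprime_dvd_mult_right_iff)
  qed
  moreover have "\<bar>c1\<bar> = 1"
  proof (rule A_mat_0_primitive[OF indep m(1)])
    fix j assume "j \<le> length al"
    then have "c1 dvd d1 * ?w ! j" using eq1[of 0 j] by (metis dvd_triv_left zero_le)
    then show "c1 dvd ?w ! j" using dc(3) by (simp add: coprime_dvd_mult_right_iff coprime_commute)
  qed
  moreover have "c1 \<noteq> - d1"
  proof
    assume neg: "c1 = - d1"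
    have "?w = map uminus ?w'"
    proof (rule nth_equalityI)
      fix j assume "j < length ?w"
      then have "j \<le> length al" using len m by simp
      then have "d1 * ?w ! j = d1 * (- ?w' ! j)" using eq1[of 0 j] neg by simp
      moreover have "d1 \<noteq> 0" using \<open>\<bar>d1\<bar> = 1\<close> by auto
      ultimately have "?w ! j = - ?w' ! j" by (metis mult_left_cancel)
      then show "?w ! j = map uminus ?w' ! j" using \<open>j \<le> length al\<close> len m by simp
    qed (use len m in simp)
    then show False
      using first_nz_pos_not_uminus A_mat_first_nz_pos[OF indep m(1), of 0]
        A_mat_first_nz_pos[OF indep m(2), of 0] by auto
  qed
  ultimately have "c1 = d1" "d1 \<noteq> 0" by auto
  then have nth: "A_mat al m ! i ! j = A_mat al m' ! i ! j" if "i \<le> length al" "j \<le> length al" for i j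
    using eq1[OF that] by simp
  show ?thesis
  proof (rule nth_equalityI)
    fix i assume "i < length (A_mat al m)"
    then have i: "i \<le> length al" by simp
    show "A_mat al m ! i = A_mat al m' ! i"
      by (rule nth_equalityI) (use i len m nth in auto)
  qed simp
qed

lemma length_act [simp]: "length (act B al) = length al"
  by (simp add: act_def)

text \<open>The image records exactly the values of the rows relative to the value of the last row;
  both directions of the theorem work with these quotients only.\<close>

lemma act_nth: "i < length al \<Longrightarrow> act B al ! i = xi al (B ! i) / xi al (B ! length al)"
  by (simp add: act_def xi_def)

subsection \<open>Cramer's rule and determinant bounds\<close>

text \<open>The adjugate replaces the inverse matrix so that all coefficients stay integral. It is
  needed on both sides: \<open>act_A_mat_inj\<close> first multiplies by it and then undoes
  this.\<close>

lemma int_mat_adjugate: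
  obtains g :: "nat \<Rightarrow> nat \<Rightarrow> int" where
    "\<And>i j. i < l \<Longrightarrow> j < l \<Longrightarrow> (\<Sum>k<l. g i k * f k ! j) = (if i = j then det (int_mat l f) else 0)"
    "\<And>i j. i < l \<Longrightarrow> j < l \<Longrightarrow> (\<Sum>k<l. f i ! k * g k j) = (if i = j then det (int_mat l f) else 0)"
proof
  let ?A = "int_mat l f"
  note adj = adj_mat[OF int_mat_carrier[of l f]]
  fix i j assume ij: "i < l" "j < l"
  have "(adj_mat ?A * ?A) $$ (i, j) = (\<Sum>k<l. adj_mat ?A $$ (i, k) * f k ! j)"
    using ij adj(1) by (auto simp: scalar_prod_def lessThan_atLeast0 intro!: sum.cong)
  then show "(\<Sum>k<l. adj_mat ?A $$ (i, k) * f k ! j) = (if i = j then det ?A else 0)"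
    using ij adj(3) by (cases "i = j") simp_all
  have "(?A * adj_mat ?A) $$ (i, j) = (\<Sum>k<l. f i ! k * adj_mat ?A $$ (k, j))"
    using ij adj(1) by (auto simp: scalar_prod_def lessThan_atLeast0 intro!: sum.cong)
  then show "(\<Sum>k<l. f i ! k * adj_mat ?A $$ (k, j)) = (if i = j then det ?A else 0)"
    using ij adj(2) by (cases "i = j") simp_all
qed

lemma cramer_int_mat:
  assumes det: "det (int_mat l f) \<noteq> 0" and j: "j < l" and u: "length u = l"
  shows "det (int_mat l f) * u ! j = (\<Sum>k<l. det (int_mat l (f(k := u))) * f k ! j)"
proof -
  define d where "d = det (int_mat l f)"
  obtain g where g:
    "\<And>i j. i < l \<Longrightarrow> j < l \<Longrightarrow> (\<Sum>k<l. g i k * f k ! j) = (if i = j then d else 0)"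
    unfolding d_def by (rule int_mat_adjugate[of l f]) blast
  define t where "t = (\<lambda>k. \<Sum>h<l. u ! h * g h k)"
  have t: "(\<Sum>k<l. t k * f k ! j) = d * u ! j" if "j < l" for j
  proof -
    have "(\<Sum>k<l. t k * f k ! j) = (\<Sum>k<l. \<Sum>h<l. u ! h * (g h k * f k ! j))"
      by (simp add: t_def sum_distrib_right mult.assoc)
    also have "\<dots> = (\<Sum>h<l. u ! h * (\<Sum>k<l. g h k * f k ! j))"
      by (subst sum.swap) (simp add: sum_distrib_left)
    also have "\<dots> = (\<Sum>h<l. if h = j then d * u ! j else 0)"
      using that by (intro sum.cong) (auto simp: g)
    finally show ?thesis using that by simp
  qed
  have "t k = det (int_mat l (f(k := u)))" if k: "k < l" for k
  proof -
    let ?A = "transpose_mat (int_mat l f)"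
    have dA: "det ?A = d" unfolding d_def by (rule det_transpose[of _ l]) simp
    have Ax: "?A *\<^sub>v vec l t = vec l (\<lambda>j. d * u ! j)"
    proof (rule eq_vecI)
      fix j assume "j < dim_vec (vec l (\<lambda>j. d * u ! j))"
      then have "j < l" by simp
      then have "(?A *\<^sub>v vec l t) $ j = (\<Sum>k<l. t k * f k ! j)"
        by (auto simp: scalar_prod_def lessThan_atLeast0 mult.commute intro!: sum.cong)
      with \<open>j < l\<close> t show "(?A *\<^sub>v vec l t) $ j = vec l (\<lambda>j. d * u ! j) $ j" by simp
    qed simp
    \<comment> \<open>In transposed form, the replaced column \<open>d * u\<close> is the row
      \<open>u\<close> of \<open>f(k := u)\<close> scaled by \<open>d\<close>. Hence both
      evaluations of the determinant contain the factor \<open>d\<close>, which cancels.\<close>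
    have "replace_col ?A (?A *\<^sub>v vec l t) k = transpose_mat (multrow k d (int_mat l (f(k := u))))"
      unfolding Ax by (rule eq_matI) (use k in \<open>auto simp: replace_col_def\<close>)
    then have "det (replace_col ?A (?A *\<^sub>v vec l t) k) = d * det (int_mat l (f(k := u)))"
      using k by (simp add: det_transpose[of _ l] det_multrow[of _ l])
    moreover have "det (replace_col ?A (?A *\<^sub>v vec l t) k) = t k * d"
      using cramer_lemma_mat[of ?A l "vec l t" k] k dA by simp
    ultimately show ?thesis using det by (simp add: d_def)
  qed
  then show ?thesis using t[OF j] by (simp add: d_def)
qed

lemma cramer_xi:
  assumes "det (int_mat (Suc (length al)) f) \<noteq> 0" "length u = Suc (length al)"
  shows "of_int (det (int_mat (Suc (length al)) f)) * xi al u
    = (\<Sum>k<Suc (length al). of_int (det (int_mat (Suc (length al)) (f(k := u)))) * xi al (f k))"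
proof -
  let ?l = "Suc (length al)"
  have eq: "real_of_int (det (int_mat ?l f)) * of_int (u ! j)
      = (\<Sum>k<?l. of_int (det (int_mat ?l (f(k := u)))) * of_int (f k ! j))" if "j < ?l" for j
    using arg_cong[OF cramer_int_mat[OF assms(1) that assms(2)], of real_of_int]
    by (simp only: of_int_mult of_int_sum)
  have "of_int (det (int_mat ?l f)) * xi al u
      = (\<Sum>j<?l. (of_int (det (int_mat ?l f)) * of_int (u ! j)) * (al @ [1]) ! j)"
    unfolding xi_eq_sum by (simp only: sum_distrib_left mult.assoc)
  also have "\<dots> = (\<Sum>j<?l. (\<Sum>k<?l. of_int (det (int_mat ?l (f(k := u)))) * of_int (f k ! j)) * (al @ [1]) ! j)"
    using eq by (intro sum.cong) simp_all
  also have "\<dots> = (\<Sum>k<?l. of_int (det (int_mat ?l (f(k := u)))) * xi al (f k))"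
    unfolding xi_eq_sum sum_distrib_right sum_distrib_left mult.assoc by (rule sum.swap)
  finally show ?thesis .
qed

text \<open>Each term of the Leibniz expansion takes one entry from every column. The bound may vary
  with the column because one column will hold the small values of the linear form.\<close>

lemma abs_det_le_prod:
  fixes A :: "real mat"
  assumes A: "A \<in> carrier_mat n n" and le: "\<And>i j. i < n \<Longrightarrow> j < n \<Longrightarrow> \<bar>A $$ (i, j)\<bar> \<le> g j"
  shows "\<bar>det A\<bar> \<le> fact n * (\<Prod>j<n. g j)"
proof -
  have "\<bar>det A\<bar> \<le> (\<Sum>p | p permutes {0..<n}. \<bar>signof p * (\<Prod>i = 0..<n. A $$ (i, p i))\<bar>)"
    unfolding det_def'[OF A] by (rule sum_abs)
  also have "\<dots> \<le> (\<Sum>p | p permutes {0..<n}. \<Prod>j<n. g j)"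
  proof (rule sum_mono)
    fix p assume "p \<in> {p. p permutes {0..<n}}"
    then have p: "p permutes {0..<n}" by simp
    have "\<bar>signof p * (\<Prod>i = 0..<n. A $$ (i, p i))\<bar> = (\<Prod>i = 0..<n. \<bar>A $$ (i, p i)\<bar>)"
      by (simp add: abs_mult abs_prod sign_def)
    also have "\<dots> \<le> (\<Prod>i = 0..<n. g (p i))"
      using permutes_in_image[OF p] by (intro prod_mono) (auto intro: le)
    also have "\<dots> = (\<Prod>j<n. g j)"
      using prod.permute[OF p, of g] by (simp add: comp_def lessThan_atLeast0)
    finally show "\<bar>signof p * (\<Prod>i = 0..<n. A $$ (i, p i))\<bar> \<le> (\<Prod>j<n. g j)" .
  qed
  also have "\<dots> = fact n * (\<Prod>j<n. g j)" by (simp add: card_permutations)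
  finally show ?thesis .
qed

text \<open>Adding the multiples of the other columns by the entries of \<open>al\<close> to the last column
  turns the latter into the values of the linear form, which leaves the determinant unchanged.\<close>

lemma abs_det_int_mat_le:
  assumes entries: "\<And>i j. i \<le> length al \<Longrightarrow> j \<le> length al \<Longrightarrow> \<bar>real_of_int (f i ! j)\<bar> \<le> a"
    and forms: "\<And>i. i \<le> length al \<Longrightarrow> \<bar>xi al (f i)\<bar> \<le> b"
  shows "\<bar>real_of_int (det (int_mat (Suc (length al)) f))\<bar>
    \<le> fact (Suc (length al)) * (a ^ length al * b)"
proof -
  let ?l = "Suc (length al)"
  define A :: "real mat" where "A = map_mat of_int (int_mat ?l f)"
  define v where "v = vec ?l (\<lambda>j. (al @ [1]) ! j)"
  have A: "A \<in> carrier_mat ?l ?l" and v: "v \<in> carrier_vec ?l" by (simp_all add: A_def v_def)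
  have Av: "(A *\<^sub>v v) $ i = xi al (f i)" if "i < ?l" for i
    unfolding xi_eq_sum using that
    by (auto simp: A_def v_def scalar_prod_def lessThan_atLeast0 simp del: sum.op_ivl_Suc intro!: sum.cong)
  have "real_of_int (det (int_mat ?l f)) = det A"
    unfolding A_def by (rule of_int_hom.hom_det[symmetric])
  \<comment> \<open>The last entry of \<open>v\<close> is the appended 1, which is why replacing the
    last column by \<open>A *\<^sub>v v\<close> does not change the determinant.\<close>
  also have "\<dots> = v $ length al * det A" by (simp add: v_def)
  also have "\<dots> = det (replace_col A (A *\<^sub>v v) (length al))"
    using cramer_lemma_mat[OF A v, of "length al"] by simp
  also have "\<bar>\<dots>\<bar> \<le> fact ?l * (\<Prod>j<?l. if j = length al then b else a)"
  proof (rule abs_det_le_prod)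
    fix i j assume "i < ?l" "j < ?l"
    then show "\<bar>replace_col A (A *\<^sub>v v) (length al) $$ (i, j)\<bar> \<le> (if j = length al then b else a)"
      using A Av[of i] entries[of i j] forms[of i] by (auto simp: replace_col_def A_def)
  qed (use A in \<open>simp add: replace_col_def\<close>)
  also have "(\<Prod>j<?l. if j = length al then b else a) = a ^ length al * b"
    by (simp add: prod.If_cases Int_absorb2 subset_iff)
  finally show ?thesis .
qed

subsection \<open>Powers of a real number\<close>

lemma length_pow_vec [simp]: "length (pow_vec n \<alpha>) = n"
  by (simp add: pow_vec_def)

lemma pow_vec_append_nth: "j < Suc n \<Longrightarrow> (pow_vec n \<alpha> @ [1]) ! j = \<alpha> ^ (n - j)"
  by (auto simp: pow_vec_def nth_append less_Suc_eq)

lemma xi_pow_vec: "xi (pow_vec n \<alpha>) w = (\<Sum>j<Suc n. of_int (w ! j) * \<alpha> ^ (n - j))"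
  unfolding xi_eq_sum by (intro sum.cong) (simp_all add: pow_vec_append_nth)

text \<open>Vectors list their coordinates by descending powers, polynomials by ascending ones; this
  reindexing passes between the two.\<close>

lemma sum_mult_power_rev:
  fixes x :: "'a::comm_semiring_1"
  shows "(\<Sum>j<Suc n. f (n - j) * x ^ (n - j)) = (\<Sum>k<Suc n. f k * x ^ k)"
  using sum.nat_diff_reindex[of "\<lambda>k. f k * x ^ k" "Suc n"] by simp

lemma poly_map_poly_of_rat:
  assumes "degree p \<le> n"
  shows "poly (map_poly of_rat p) (x::real) = (\<Sum>k<Suc n. of_rat (coeff p k) * x ^ k)"
proof -
  have deg: "degree (map_poly of_rat p :: real poly) = degree p" by (rule degree_map_poly) simp
  have "poly (map_poly of_rat p) x = (\<Sum>k\<le>degree p. of_rat (coeff p k) * x ^ k)"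
    by (simp add: poly_altdef coeff_map_poly deg)
  also have "\<dots> = (\<Sum>k<Suc n. of_rat (coeff p k) * x ^ k)"
    using assms by (intro sum.mono_neutral_left) (auto simp: coeff_eq_0)
  finally show ?thesis .
qed

text \<open>A root polynomial of degree at most \<open>n\<close> would be a forbidden rational
  relation. Consequently any nonzero root polynomial of degree \<open>n + 1\<close> automatically
  has minimal degree.\<close>

lemma root_imp_degree_gt:
  assumes "lin_indep_Q (pow_vec n \<alpha>)" "q \<noteq> 0" "poly (map_poly of_rat q) \<alpha> = 0"
  shows "n < degree q"
proof (rule ccontr)
  assume "\<not> n < degree q"
  then have deg: "degree q \<le> n" by simp
  have "(\<Sum>j<Suc n. of_rat (coeff q (n - j)) * \<alpha> ^ (n - j)) = 0"
    using assms(3) unfolding poly_map_poly_of_rat[OF deg] by (subst sum_mult_power_rev)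
  then have "\<forall>j\<le>n. coeff q (n - j) = 0"
    using assms(1)[unfolded lin_indep_Q_def, rule_format, of "\<lambda>j. coeff q (n - j)"]
    by (simp add: pow_vec_def)
  then have "coeff q k = 0" if "k \<le> n" for k
    using that by (metis diff_diff_cancel diff_le_self)
  with deg have "lead_coeff q = 0" by blast
  with assms(2) show False by simp
qed

text \<open>A nontrivial relation would be a root polynomial of degree exactly \<open>n + 1\<close>,
  minimal by \<open>root_imp_degree_gt\<close>, so that \<alpha> would have the excluded
  degree.\<close>

lemma lin_indep_powers_Suc:
  fixes c :: "nat \<Rightarrow> int"
  assumes "lin_indep_Q (pow_vec n \<alpha>)" "\<not> alg_degree_Q \<alpha> (n + 1)"
    and sum: "(\<Sum>k<Suc (Suc n). of_int (c k) * \<alpha> ^ k) = 0" and k: "k \<le> Suc n"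
  shows "c k = 0"
proof -
  define p :: "rat poly" where "p = (\<Sum>k<Suc (Suc n). monom (of_int (c k)) k)"
  have coeff: "coeff p k = (if k < Suc (Suc n) then of_int (c k) else 0)" for k
    unfolding p_def coeff_sum coeff_monom by (simp only: sum.delta finite_lessThan lessThan_iff)
  then have deg: "degree p \<le> Suc n" by (intro degree_le) auto
  have root: "poly (map_poly of_rat p) \<alpha> = 0"
    unfolding poly_map_poly_of_rat[OF deg] sum[symmetric] by (intro sum.cong) (simp_all add: coeff)
  have "p = 0"
  proof (rule ccontr)
    assume "p \<noteq> 0"
    then have "degree p = n + 1" using root_imp_degree_gt[OF assms(1) _ root] deg by simp
    moreover have "degree p \<le> degree q" if "q \<noteq> 0" "poly (map_poly of_rat q) \<alpha> = 0" for q
      using root_imp_degree_gt[OF assms(1) that] \<open>degree p = n + 1\<close> by simp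
    ultimately show False using assms(2) \<open>p \<noteq> 0\<close> root unfolding alg_degree_Q_def by blast
  qed
  then show ?thesis using coeff[of k] k by simp
qed

text \<open>If the vector of powers is an eigenvector, then row \<open>i\<close> represents
  \<open>\<alpha>\<close> times the number represented by row \<open>i + 1\<close>; without a relation of degree \<open>n + 1\<close>
  this holds for the polynomials, so the matrix is constant along its diagonals
  and nothing survives off the main one.\<close>

lemma eigenvector_powers_imp_scalar:
  fixes R :: "nat \<Rightarrow> nat \<Rightarrow> int"
  assumes "lin_indep_Q (pow_vec n \<alpha>)" "\<not> alg_degree_Q \<alpha> (n + 1)"
    and eig: "\<And>i. i \<le> n \<Longrightarrow> (\<Sum>j<Suc n. of_int (R i j) * \<alpha> ^ (n - j)) = s * \<alpha> ^ (n - i)"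
    and ij: "i \<le> n" "j \<le> n"
  shows "R i j = (if i = j then R n n else 0)"
proof -
  \<comment> \<open>Both sides are coefficients of \<alpha>^k: on the left for row \<open>i\<close>,
    on the right for \<alpha> times row \<open>i + 1\<close>. The conditionals supply the missing
    coefficients at \<open>k = n + 1\<close> and \<open>k = 0\<close>.\<close>
  have e: "(if k \<le> n then R i (n - k) else 0) = (if k = 0 then 0 else R (Suc i) (n - (k - 1)))"
    if "i < n" "k \<le> Suc n" for i k
  proof -
    define e where "e = (\<lambda>k. if k \<le> n then R i (n - k) else 0)"
    define e' where "e' = (\<lambda>k. if k = 0 then 0 else R (Suc i) (n - (k - 1)))"
    have R: "(\<Sum>k<Suc n. of_int (R i (n - k)) * \<alpha> ^ k) = s * \<alpha> ^ (n - i)" if "i \<le> n" for i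
    proof -
      have "(\<Sum>k<Suc n. of_int (R i (n - k)) * \<alpha> ^ k)
          = (\<Sum>j<Suc n. of_int (R i (n - (n - j))) * \<alpha> ^ (n - j))"
        by (rule sum_mult_power_rev[symmetric])
      also have "\<dots> = (\<Sum>j<Suc n. of_int (R i j) * \<alpha> ^ (n - j))"
        by (intro sum.cong) auto
      finally show ?thesis using eig[OF that] by simp
    qed
    have "(\<Sum>k<Suc (Suc n). of_int (e k) * \<alpha> ^ k) = (\<Sum>k<Suc n. of_int (R i (n - k)) * \<alpha> ^ k)"
      by (subst sum.lessThan_Suc) (auto simp: e_def intro!: sum.cong)
    also have "\<dots> = s * \<alpha> ^ (n - i)" using \<open>i < n\<close> by (intro R) simp
    also have "\<dots> = \<alpha> * (s * \<alpha> ^ (n - Suc i))"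
      using \<open>i < n\<close> by (simp add: Suc_diff_Suc[symmetric])
    also have "\<dots> = \<alpha> * (\<Sum>k<Suc n. of_int (R (Suc i) (n - k)) * \<alpha> ^ k)"
      using \<open>i < n\<close> by (subst R) auto
    also have "\<dots> = (\<Sum>k<Suc (Suc n). of_int (e' k) * \<alpha> ^ k)"
      by (subst (2) sum.lessThan_Suc_shift) (simp add: e'_def sum_distrib_left ac_simps del: sum.lessThan_Suc)
    finally have "(\<Sum>k<Suc (Suc n). of_int (e k - e' k) * \<alpha> ^ k) = 0"
      by (simp only: of_int_diff left_diff_distrib sum_subtractf)
    then have "e k - e' k = 0"
      using lin_indep_powers_Suc[OF assms(1,2), of "\<lambda>k. e k - e' k" k] \<open>k \<le> Suc n\<close> by simp
    then show ?thesis by (simp add: e_def e'_def)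
  qed
  have last: "R i n = 0" if "i < n" for i
    using e[OF that, of 0] by simp
  have first: "R (Suc i) 0 = 0" if "i < n" for i
    using e[OF that, of "Suc n"] by simp
  have diag: "R (Suc i) (Suc j) = R i j" if "i < n" "j < n" for i j
    using e[OF that(1), of "n - j"] that(2) by (simp add: Suc_diff_le[symmetric])
  have shift: "R (i + d) (j + d) = R i j" if "i + d \<le> n" "j + d \<le> n" for i j d
    using that by (induction d) (auto simp: diag)
  \<comment> \<open>An entry is moved along its diagonal: to the corner if it lies on the main
    diagonal, to the vanishing last column if above it, and to the vanishing first column if below
    it.\<close>
  consider "i = j" | "i < j" | "j < i" by linarith
  then show ?thesis
  proof cases
    case 1
    then show ?thesis using shift[of i "n - i" i] ij by simp
  next
    case 2
    then show ?thesis using shift[of i "n - j" j] last[of "i + (n - j)"] ij by simp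
  next
    case 3
    then show ?thesis using shift[of "i - j" j 0] first[of "i - j - 1"] ij by (simp add: Suc_diff_Suc)
  qed
qed

lemma act_A_mat_inj:
  fixes n :: nat and \<alpha> :: real
  defines "al \<equiv> pow_vec n \<alpha>"
  assumes indep: "lin_indep_Q al" and "\<not> alg_degree_Q \<alpha> (n + 1)" and m: "1 \<le> m" "1 \<le> m'"
    and act: "act (A_mat al m) al = act (A_mat al m') al"
  shows "A_mat al m = A_mat al m'"
proof -
  have len: "length al = n" by (simp add: al_def)
  let ?f = "(!) (A_mat al m)" and ?f' = "(!) (A_mat al m')"
  define d where "d = det (int_mat (Suc n) ?f')"
  have "d \<noteq> 0" using det_A_mat_nonzero[OF indep m(2)] by (simp add: d_def len)
  \<comment> \<open>Equal images make the values of corresponding rows proportional; the factor is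
    read off from the last rows, whose values are the denominators of the action.\<close>
  define s where "s = xi al (?f n) / xi al (?f' n)"
  have nz: "xi al (?f n) \<noteq> 0" "xi al (?f' n) \<noteq> 0"
    using xi_A_mat_nth_nonzero[OF indep] m len by auto
  have s: "xi al (?f i) = s * xi al (?f' i)" if "i \<le> n" for i
  proof (cases "i = n")
    case True
    then show ?thesis using nz by (simp add: s_def)
  next
    case False
    with that have "i < length al" by (simp add: len)
    then have "xi al (?f i) / xi al (?f n) = xi al (?f' i) / xi al (?f' n)"
      using act act_nth[of i al] len by metis
    then show ?thesis using nz by (simp add: s_def field_simps)
  qed
  obtain g where g:
    "\<And>i j. i < Suc n \<Longrightarrow> j < Suc n \<Longrightarrow> (\<Sum>k<Suc n. g i k * ?f' k ! j) = (if i = j then d else 0)"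
    "\<And>i j. i < Suc n \<Longrightarrow> j < Suc n \<Longrightarrow> (\<Sum>k<Suc n. ?f' i ! k * g k j) = (if i = j then d else 0)"
    using int_mat_adjugate[of "Suc n" ?f'] unfolding d_def by blast
  define R where "R = (\<lambda>i j. \<Sum>k<Suc n. g i k * ?f k ! j)"
  have "(\<Sum>j<Suc n. of_int (R i j) * \<alpha> ^ (n - j)) = (s * of_int d) * \<alpha> ^ (n - i)" if "i \<le> n" for i
  proof -
    have swap: "(\<Sum>j<Suc n. of_int (\<Sum>k<Suc n. g i k * h k ! j) * \<alpha> ^ (n - j))
        = (\<Sum>k<Suc n. of_int (g i k) * xi al (h k))" for h :: "nat \<Rightarrow> int list"
      unfolding al_def xi_pow_vec of_int_sum of_int_mult sum_distrib_left sum_distrib_right mult.assoc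
      by (rule sum.swap)
    have "(\<Sum>j<Suc n. of_int (R i j) * \<alpha> ^ (n - j)) = (\<Sum>k<Suc n. of_int (g i k) * xi al (?f k))"
      unfolding R_def by (rule swap)
    also have "\<dots> = s * (\<Sum>k<Suc n. of_int (g i k) * xi al (?f' k))"
      unfolding sum_distrib_left by (intro sum.cong) (auto simp: s)
    also have "(\<Sum>k<Suc n. of_int (g i k) * xi al (?f' k))
        = (\<Sum>j<Suc n. of_int (\<Sum>k<Suc n. g i k * ?f' k ! j) * \<alpha> ^ (n - j))"
      by (rule swap[symmetric])
    also have "\<dots> = (\<Sum>j<Suc n. if j = i then of_int d * \<alpha> ^ (n - i) else 0)"
      using that by (intro sum.cong) (auto simp: g(1) simp del: sum.lessThan_Suc)
    also have "\<dots> = of_int d * \<alpha> ^ (n - i)"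
      using that by (simp only: sum.delta finite_lessThan lessThan_iff less_Suc_eq_le if_True)
    finally show ?thesis by simp
  qed
  then have R: "R i j = (if i = j then R n n else 0)" if "i \<le> n" "j \<le> n" for i j
    using eigenvector_powers_imp_scalar[of n \<alpha> R "s * of_int d" i j] assms(3) indep that
    by (simp add: al_def)
  \<comment> \<open>Multiplying the scalar matrix \<open>R\<close> by the second matrix from the
    left cancels the adjugate and leaves \<open>d\<close> times the first matrix.\<close>
  have "d * ?f i ! j = R n n * ?f' i ! j" if "i \<le> n" "j \<le> n" for i j
  proof -
    have "d * ?f i ! j = (\<Sum>h<Suc n. if h = i then d * ?f i ! j else 0)"
      using that by (simp only: sum.delta finite_lessThan lessThan_iff less_Suc_eq_le if_True)
    also have "\<dots> = (\<Sum>h<Suc n. (\<Sum>k<Suc n. ?f' i ! k * g k h) * ?f h ! j)"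
      using that by (intro sum.cong) (auto simp: g(2) simp del: sum.lessThan_Suc)
    also have "\<dots> = (\<Sum>k<Suc n. ?f' i ! k * R k j)"
      unfolding R_def sum_distrib_left sum_distrib_right mult.assoc by (rule sum.swap)
    also have "\<dots> = (\<Sum>k<Suc n. if k = j then R n n * ?f' i ! j else 0)"
    proof (intro sum.cong refl)
      fix k assume "k \<in> {..<Suc n}"
      then show "?f' i ! k * R k j = (if k = j then R n n * ?f' i ! j else 0)"
        using R[of k j] that by simp
    qed
    also have "\<dots> = R n n * ?f' i ! j"
      using that by (simp only: sum.delta finite_lessThan lessThan_iff less_Suc_eq_le if_True)
    finally show ?thesis .
  qed
  then show ?thesis
    using A_mat_proportional_imp_eq[OF indep m \<open>d \<noteq> 0\<close>, of "R n n"] by (simp add: len)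
qed

subsection \<open>Multiplication by an algebraic number\<close>

text \<open>Multiplication by \<open>D * \<alpha>\<close> in coordinates: entries move one power up
  with a factor \<open>D\<close>, and the term with \<alpha>^(n+1) that arises from the leading
  entry is rewritten by the relation with coefficients \<open>c\<close>. The factor \<open>D\<close>
  keeps the entries integral.\<close>

definition mult_step :: "int \<Rightarrow> (nat \<Rightarrow> int) \<Rightarrow> int list \<Rightarrow> int list" where
  "mult_step D c w =
     map (\<lambda>j. w ! 0 * c j + (if Suc j < length w then D * w ! Suc j else 0)) [0..<length w]"

lemma length_mult_step_pow [simp]: "length ((mult_step D c ^^ i) w) = length w"
  by (induction i) (simp_all add: mult_step_def)

lemma xi_mult_step:
  assumes rel: "of_int D * \<alpha> ^ Suc n = (\<Sum>j<Suc n. of_int (c j) * \<alpha> ^ (n - j))"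
    and len: "length w = Suc n"
  shows "xi (pow_vec n \<alpha>) (mult_step D c w) = (of_int D * \<alpha>) * xi (pow_vec n \<alpha>) w"
proof -
  have "xi (pow_vec n \<alpha>) (mult_step D c w)
      = of_int (w ! 0) * (\<Sum>j<Suc n. of_int (c j) * \<alpha> ^ (n - j))
        + (\<Sum>j<Suc n. (if j < n then of_int (D * w ! Suc j) else 0) * \<alpha> ^ (n - j))"
    unfolding xi_pow_vec sum_distrib_left sum.distrib[symmetric] using len
    by (intro sum.cong) (auto simp: mult_step_def algebra_simps simp del: upt_Suc)
  also have "(\<Sum>j<Suc n. (if j < n then of_int (D * w ! Suc j) else 0) * \<alpha> ^ (n - j))
      = (\<Sum>j<n. (of_int D * \<alpha>) * (of_int (w ! Suc j) * \<alpha> ^ (n - Suc j)))"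
    by (subst sum.lessThan_Suc)
      (auto intro!: sum.cong simp: Suc_diff_Suc[symmetric] simp del: sum.lessThan_Suc)
  also have "of_int (w ! 0) * (\<Sum>j<Suc n. of_int (c j) * \<alpha> ^ (n - j)) + \<dots>
      = (of_int D * \<alpha>) * xi (pow_vec n \<alpha>) w"
    unfolding rel[symmetric] xi_pow_vec by (subst sum.lessThan_Suc_shift) (simp add: sum_distrib_left algebra_simps)
  finally show ?thesis .
qed

lemma xi_mult_step_pow:
  assumes "of_int D * \<alpha> ^ Suc n = (\<Sum>j<Suc n. of_int (c j) * \<alpha> ^ (n - j))"
    and "length w = Suc n"
  shows "xi (pow_vec n \<alpha>) ((mult_step D c ^^ i) w) = (of_int D * \<alpha>) ^ i * xi (pow_vec n \<alpha>) w"
proof (induction i)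
  case (Suc i)
  then show ?case using xi_mult_step[OF assms(1), of "(mult_step D c ^^ i) w"] assms(2) by simp
qed simp

lemma sup_norm_mult_step:
  assumes E: "\<bar>D\<bar> + (\<Sum>j<length w. \<bar>c j\<bar>) \<le> int E" and w: "sup_norm w \<le> int m"
  shows "sup_norm (mult_step D c w) \<le> int (E * m)"
proof (rule sup_norm_leI)
  fix j assume "j < length (mult_step D c w)"
  then have j: "j < length w" by (simp add: mult_step_def)
  have "\<bar>c j\<bar> \<le> (\<Sum>j<length w. \<bar>c j\<bar>)"
    using j by (intro member_le_sum) auto
  have "\<bar>w ! 0\<bar> \<le> int m" by (rule sup_norm_nth_le[OF w]) (use j in linarith)
  then have 1: "\<bar>w ! 0 * c j\<bar> \<le> int m * \<bar>c j\<bar>"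
    unfolding abs_mult by (rule mult_right_mono) simp
  have 2: "\<bar>if Suc j < length w then D * w ! Suc j else 0\<bar> \<le> int m * \<bar>D\<bar>"
    using sup_norm_nth_le[OF w, of "Suc j"]
    by (auto simp: abs_mult mult.commute[of "\<bar>D\<bar>"] intro: mult_right_mono)
  have "mult_step D c w ! j = w ! 0 * c j + (if Suc j < length w then D * w ! Suc j else 0)"
    using j by (simp add: mult_step_def)
  then have "\<bar>mult_step D c w ! j\<bar> \<le> int m * \<bar>c j\<bar> + int m * \<bar>D\<bar>"
    using order_trans[OF abs_triangle_ineq add_mono[OF 1 2]] by simp
  also have "\<dots> = int m * (\<bar>c j\<bar> + \<bar>D\<bar>)" by (simp add: algebra_simps)
  also have "\<dots> \<le> int m * int E"
    using E \<open>\<bar>c j\<bar> \<le> _\<close> by (intro mult_left_mono) auto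
  finally show "\<bar>mult_step D c w ! j\<bar> \<le> int (E * m)" by (simp add: mult.commute)
qed

lemma sup_norm_mult_step_pow:
  assumes "\<bar>D\<bar> + (\<Sum>j<length w. \<bar>c j\<bar>) \<le> int E" "sup_norm w \<le> int m"
  shows "sup_norm ((mult_step D c ^^ i) w) \<le> int (E ^ i * m)"
proof (induction i)
  case (Suc i)
  then show ?case using sup_norm_mult_step[of D c "(mult_step D c ^^ i) w" E "E ^ i * m"] assms(1)
    by (simp add: mult.assoc)
qed (use assms in simp)

text \<open>Applying the form to a relation between the rows yields the value of \<open>w\<close>
  times a polynomial in \<open>D * \<alpha>\<close> of degree at most \<open>n\<close>; independence
  of the powers then kills every coefficient.\<close>

lemma det_mult_step_nonzero:
  assumes indep: "lin_indep_Q (pow_vec n \<alpha>)" and "D \<noteq> 0"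
    and rel: "of_int D * \<alpha> ^ Suc n = (\<Sum>j<Suc n. of_int (c j) * \<alpha> ^ (n - j))"
    and len: "length w = Suc n" and xi: "xi (pow_vec n \<alpha>) w \<noteq> 0"
  shows "det (int_mat (Suc n) (\<lambda>i. (mult_step D c ^^ i) w)) \<noteq> 0"
proof
  let ?f = "\<lambda>i. (mult_step D c ^^ i) w"
  assume "det (int_mat (Suc n) ?f) = 0"
  then obtain t k where t: "k < Suc n" "t k \<noteq> 0"
    "\<And>j. j < Suc n \<Longrightarrow> (\<Sum>i<Suc n. t i * ?f i ! j) = 0"
    by (rule det_int_mat_eq_0D) blast
  have "(\<Sum>i<Suc n. of_int (t i) * xi (pow_vec n \<alpha>) (?f i))
      = (\<Sum>j<Suc n. of_int (\<Sum>i<Suc n. t i * ?f i ! j) * \<alpha> ^ (n - j))"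
    unfolding xi_pow_vec of_int_sum of_int_mult sum_distrib_left sum_distrib_right mult.assoc
    by (rule sum.swap)
  also have "\<dots> = 0" using t(3) by (intro sum.neutral) (simp del: sum.lessThan_Suc)
  also have "(\<Sum>i<Suc n. of_int (t i) * xi (pow_vec n \<alpha>) (?f i))
      = (\<Sum>i<Suc n. of_int (t i * D ^ i) * \<alpha> ^ i) * xi (pow_vec n \<alpha>) w"
    unfolding xi_mult_step_pow[OF rel len] sum_distrib_right
    by (intro sum.cong) (simp_all add: power_mult_distrib)
  finally have "(\<Sum>i<Suc n. of_int (t i * D ^ i) * \<alpha> ^ i) = 0" using xi by simp
  then have "(\<Sum>j<Suc n. of_int (t (n - j) * D ^ (n - j)) * \<alpha> ^ (n - j)) = 0"
    by (subst sum_mult_power_rev[of "\<lambda>i. of_int (t i * D ^ i)"])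
  also have "(\<Sum>j<Suc n. of_int (t (n - j) * D ^ (n - j)) * \<alpha> ^ (n - j))
    = (\<Sum>j<Suc (length (pow_vec n \<alpha>)). of_int (t (n - j) * D ^ (n - j)) * (pow_vec n \<alpha> @ [1]) ! j)"
    by (intro sum.cong) (simp_all add: pow_vec_append_nth)
  finally have "t (n - (n - k)) * D ^ (n - (n - k)) = 0"
    using lin_indep_QD[OF indep, of "\<lambda>j. t (n - j) * D ^ (n - j)" "n - k"] by simp
  then show False using t(1,2) \<open>D \<noteq> 0\<close> by simp
qed

section \<open>Integral relations of algebraic numbers\<close>

lemma common_denominator:
  fixes f :: "nat \<Rightarrow> rat"
  obtains d :: int and z :: "nat \<Rightarrow> int" where "d \<noteq> 0" "\<And>k. k < N \<Longrightarrow> of_int d * f k = of_int (z k)"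
proof -
  have "\<exists>d::int. d \<noteq> 0 \<and> (\<forall>k<N. \<exists>z::int. of_int d * f k = of_int z)"
  proof (induction N)
    case (Suc N)
    then obtain d where d: "d \<noteq> 0" "\<And>k. k < N \<Longrightarrow> \<exists>z::int. of_int d * f k = of_int z" by blast
    obtain a b where ab: "quotient_of (f N) = (a, b)" by fastforce
    have b: "b \<noteq> 0" "f N = of_int a / of_int b"
      using quotient_of_denom_pos[OF ab] quotient_of_div[OF ab] by auto
    have "\<exists>z::int. of_int (b * d) * f k = of_int z" if "k < Suc N" for k
    proof (cases "k = N")
      case True
      then show ?thesis using b by (intro exI[of _ "a * d"]) simp
    next
      case False
      with that obtain z where "of_int d * f k = of_int z" using d(2)[of k] by auto
      then show ?thesis by (intro exI[of _ "b * z"]) (simp add: mult.assoc)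
    qed
    then show ?case using d(1) b(1) by (intro exI[of _ "b * d"]) auto
  qed (auto intro: exI[of _ 1])
  then obtain d :: int where "d \<noteq> 0" "\<forall>k<N. \<exists>z::int. of_int d * f k = of_int z" by blast
  then show ?thesis using that by metis
qed

lemma alg_degree_Q_relation:
  assumes "alg_degree_Q \<alpha> (n + 1)"
  obtains D c where "D \<noteq> 0" "of_int D * \<alpha> ^ Suc n = (\<Sum>j<Suc n. of_int (c j) * \<alpha> ^ (n - j))"
proof -
  obtain p where p: "p \<noteq> 0" "poly (map_poly of_rat p) \<alpha> = 0" "degree p = Suc n"
    using assms unfolding alg_degree_Q_def by auto
  obtain d z where dz: "d \<noteq> 0" "\<And>k. k < Suc (Suc n) \<Longrightarrow> of_int d * coeff p k = of_int (z k)"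
    by (rule common_denominator[of "Suc (Suc n)" "coeff p"]) blast
  have z: "of_int (z k) = real_of_int d * of_rat (coeff p k)" if "k < Suc (Suc n)" for k
    using arg_cong[OF dz(2)[OF that], of real_of_rat] by (simp add: of_rat_mult)
  have "(\<Sum>k<Suc (Suc n). of_int (z k) * \<alpha> ^ k) = of_int d * poly (map_poly of_rat p) \<alpha>"
    unfolding poly_map_poly_of_rat[OF eq_imp_le[OF p(3)]] sum_distrib_left
    by (intro sum.cong) (simp_all add: z)
  then have "of_int (z (Suc n)) * \<alpha> ^ Suc n = - (\<Sum>k<Suc n. of_int (z k) * \<alpha> ^ k)"
    using p(2) by simp
  also have "\<dots> = (\<Sum>k<Suc n. of_int (- z k) * \<alpha> ^ k)"
    by (simp add: sum_negf)
  also have "\<dots> = (\<Sum>j<Suc n. of_int (- z (n - j)) * \<alpha> ^ (n - j))"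
    by (rule sum_mult_power_rev[symmetric])
  finally have "of_int (z (Suc n)) * \<alpha> ^ Suc n = (\<Sum>j<Suc n. of_int (- z (n - j)) * \<alpha> ^ (n - j))" .
  moreover have "of_int (z (Suc n)) = real_of_int d * of_rat (lead_coeff p)"
    using z[of "Suc n"] p(3) by simp
  then have "real_of_int (z (Suc n)) \<noteq> 0"
    using p(1) dz(1) by simp
  then have "z (Suc n) \<noteq> 0" by simp
  ultimately show ?thesis using that[of "z (Suc n)" "\<lambda>j. - z (n - j)"] by blast
qed

section \<open>Upper bounds for the rows and finiteness of the images\<close>

lemma abs_power_le_power_Suc_abs:
  fixes x :: real
  assumes "i \<le> n"
  shows "\<bar>x ^ i\<bar> \<le> (1 + \<bar>x\<bar>) ^ n"
proof -
  have "\<bar>x ^ i\<bar> \<le> (1 + \<bar>x\<bar>) ^ i" unfolding power_abs by (rule power_mono) auto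
  also have "\<dots> \<le> (1 + \<bar>x\<bar>) ^ n" using assms by (intro power_increasing) auto
  finally show ?thesis .
qed

text \<open>One short vector with a small value yields \<open>n + 1\<close> independent ones,
  its multiples by the powers of \<open>D * \<alpha>\<close>.\<close>

lemma A_mat_xi_upper_bound:
  fixes n :: nat and \<alpha> :: real
  defines "al \<equiv> pow_vec n \<alpha>"
  assumes indep: "lin_indep_Q al" and "D \<noteq> 0"
    and rel: "of_int D * \<alpha> ^ Suc n = (\<Sum>j<Suc n. of_int (c j) * \<alpha> ^ (n - j))"
  obtains C K where "1 \<le> K" "\<And>m i. K \<le> m \<Longrightarrow> i \<le> n \<Longrightarrow> \<bar>xi al (A_mat al m ! i)\<bar> * real m ^ n \<le> C"
proof -
  have len: "length al = n" by (simp add: al_def)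
  define E where "E = nat (\<bar>D\<bar> + (\<Sum>j<Suc n. \<bar>c j\<bar>))"
  have E: "\<bar>D\<bar> + (\<Sum>j<Suc n. \<bar>c j\<bar>) \<le> int E" by (simp add: E_def)
  moreover have "0 \<le> (\<Sum>j<Suc n. \<bar>c j\<bar>)" by (rule sum_nonneg) simp
  ultimately have "1 \<le> E" using \<open>D \<noteq> 0\<close> by linarith
  \<comment> \<open>\<open>E\<close> bounds the growth of the sup norm under one multiplication
    step, so \<open>K\<close> bounds it under up to \<open>n\<close> steps.\<close>
  define K where "K = E ^ n"
  have "1 \<le> K" using \<open>1 \<le> E\<close> by (simp add: K_def)
  define H where "H = (1 + \<bar>of_int D * \<alpha>\<bar>) ^ n"
  obtain S where S: "S > 0" "\<And>m. 1 \<le> m \<Longrightarrow> \<exists>w. length w = Suc (length al) \<and> sup_norm w \<le> int m \<and>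
    (\<exists>j\<le>length al. w ! j \<noteq> 0) \<and> \<bar>xi al w\<bar> * real m ^ length al \<le> S"
    using ex_small_xi[of al] by blast
  have "\<bar>xi al (A_mat al m ! i)\<bar> * real m ^ n \<le> H * S * (2 * real K) ^ n"
    if m: "K \<le> m" and i: "i \<le> n" for m i
  proof -
    \<comment> \<open>The pigeonhole principle is applied in the smaller box of size
      \<open>q\<close>, so that all multiples of the vector still fit into the box of size
      \<open>m\<close>. As \<open>m\<close> is at most \<open>2 * K * q\<close>, this costs only a
      constant factor.\<close>
    define q where "q = m div K"
    have "1 \<le> q" using div_le_mono[OF m, of K] \<open>1 \<le> K\<close> by (simp add: q_def)
    have "K * q \<le> m" by (simp add: q_def)
    have "m < K * q + K"
      using dividend_less_times_div[of K m] \<open>1 \<le> K\<close> by (simp add: q_def add.commute)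
    also have "\<dots> \<le> 2 * K * q" using \<open>1 \<le> q\<close> \<open>1 \<le> K\<close> by simp
    finally have m_le: "real m \<le> 2 * real K * real q"
      by (metis less_imp_le of_nat_le_iff of_nat_mult of_nat_numeral)
    have "1 \<le> m" using m \<open>1 \<le> K\<close> by simp
    obtain w j where w: "length w = Suc n" "sup_norm w \<le> int q" "j \<le> length al" "w ! j \<noteq> 0"
      "\<bar>xi al w\<bar> * real q ^ n \<le> S" using S(2)[OF \<open>1 \<le> q\<close>] len by auto
    have nz: "xi al w \<noteq> 0" using xi_eq_0D[OF indep _ w(3)] w(4) by blast
    define f where "f = (\<lambda>i. (mult_step D c ^^ i) w)"
    have "det (int_mat (Suc n) f) \<noteq> 0"
      using det_mult_step_nonzero[OF indep[unfolded al_def] \<open>D \<noteq> 0\<close> rel w(1)] nz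
      by (simp add: f_def al_def)
    \<comment> \<open>The \<open>n + 1\<close> independent multiples cannot all lie in the span of
      the \<open>i\<close> rows already chosen; one that does not competes with row
      \<open>i\<close>.\<close>
    then obtain k where k: "k < Suc n" "\<not> in_span_Q (Suc n) (Defs.rows al m i) (f k)"
      using in_span_Q_imp_det_eq_0[of "Defs.rows al m i" "Suc n" f] i by auto
    have "sup_norm (f k) \<le> int (E ^ k * q)"
      unfolding f_def by (rule sup_norm_mult_step_pow) (use E w in simp_all)
    also have "E ^ k \<le> K" unfolding K_def using k(1) \<open>1 \<le> E\<close> by (intro power_increasing) auto
    then have "int (E ^ k * q) \<le> int m"
      using \<open>K * q \<le> m\<close> by (metis le_trans mult_le_mono1 of_nat_le_iff)
    finally have "f k \<in> cand al m (Defs.rows al m i)"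
      using k(2) w(1) by (simp add: cand_def len f_def)
    then have "\<bar>xi al (A_mat al m ! i)\<bar> \<le> \<bar>xi al (f k)\<bar>"
      using i by (intro A_mat_nth_le indep \<open>1 \<le> m\<close>) (simp_all add: len)
    also have "xi al (f k) = (of_int D * \<alpha>) ^ k * xi al w"
      unfolding f_def al_def by (rule xi_mult_step_pow[OF rel w(1)])
    also have "\<bar>\<dots>\<bar> \<le> H * \<bar>xi al w\<bar>"
      unfolding abs_mult[of "_ ^ k"] H_def using k(1) by (intro mult_right_mono abs_power_le_power_Suc_abs) auto
    finally have "\<bar>xi al (A_mat al m ! i)\<bar> * real m ^ n
        \<le> (H * \<bar>xi al w\<bar>) * (2 * real K * real q) ^ n"
      using m_le by (intro mult_mono power_mono) (auto simp: H_def)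
    also have "\<dots> = H * (\<bar>xi al w\<bar> * real q ^ n) * (2 * real K) ^ n"
      by (simp add: power_mult_distrib)
    also have "\<dots> \<le> H * S * (2 * real K) ^ n"
      using w(5) by (intro mult_right_mono mult_left_mono) (auto simp: H_def)
    finally show ?thesis .
  qed
  with \<open>1 \<le> K\<close> show ?thesis using that by blast
qed

text \<open>By Cramer's rule the quotients of the values of the rows have coordinates
  with respect to the powers of \<open>D * \<alpha>\<close> that are quotients of bounded integers.\<close>

lemma finite_act_A_mat:
  fixes n :: nat and \<alpha> :: real
  defines "al \<equiv> pow_vec n \<alpha>"
  assumes indep: "lin_indep_Q al" and alg: "alg_degree_Q \<alpha> (n + 1)"
  shows "finite ((\<lambda>m. act (A_mat al m) al) ` {1..})"
proof -
  have len: "length al = n" by (simp add: al_def)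
  obtain D c where "D \<noteq> 0" and rel: "of_int D * \<alpha> ^ Suc n = (\<Sum>j<Suc n. of_int (c j) * \<alpha> ^ (n - j))"
    by (rule alg_degree_Q_relation[OF alg])
  obtain C K where K: "1 \<le> K"
    "\<And>m i. K \<le> m \<Longrightarrow> i \<le> n \<Longrightarrow> \<bar>xi al (A_mat al m ! i)\<bar> * real m ^ n \<le> C"
    by (rule A_mat_xi_upper_bound[OF indep[unfolded al_def] \<open>D \<noteq> 0\<close> rel, folded al_def]) blast
  define E where "E = nat (\<bar>D\<bar> + (\<Sum>j<Suc n. \<bar>c j\<bar>))"
  have E: "\<bar>D\<bar> + (\<Sum>j<Suc n. \<bar>c j\<bar>) \<le> int E" by (simp add: E_def)
  moreover have "0 \<le> (\<Sum>j<Suc n. \<bar>c j\<bar>)" by (rule sum_nonneg) simp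
  ultimately have "1 \<le> E" using \<open>D \<noteq> 0\<close> by linarith
  define H where "H = (1 + \<bar>of_int D * \<alpha>\<bar>) ^ n"
  have "1 \<le> H" unfolding H_def by (rule one_le_power) simp
  define Q where "Q = fact (Suc n) * ((real E ^ n) ^ n * (H * C))"
  define Z where "Z = {x::int. \<bar>real_of_int x\<bar> \<le> Q}"
  have "finite Z"
    by (rule finite_subset[of _ "{-\<lceil>Q\<rceil>..\<lceil>Q\<rceil>}"]) (auto simp: Z_def, linarith+)
  \<comment> \<open>The possible quotients: \<open>d\<close> stands for the determinant in Cramer's
    rule and \<open>g\<close> for its numerators. A pair with \<open>d = 0\<close> contributes only
    the value 0.\<close>
  define V where "V = (\<lambda>(d, g). (\<Sum>k<Suc n. of_int (g k) * (of_int D * \<alpha>) ^ k) / of_int d)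
    ` (Z \<times> PiE {..<Suc n} (\<lambda>_. Z))"
  have "finite V" unfolding V_def using \<open>finite Z\<close> by (intro finite_imageI finite_cartesian_product finite_PiE) auto
  have "act (A_mat al m) al \<in> {xs. set xs \<subseteq> V \<and> length xs = n}" if m: "K \<le> m" for m
  proof -
    have "1 \<le> m" using m K(1) by simp
    let ?r = "\<lambda>i. A_mat al m ! i"
    \<comment> \<open>The multiples are formed from the last row because its value is the
      denominator in the action.\<close>
    define f where "f = (\<lambda>i. (mult_step D c ^^ i) (?r n))"
    have r: "length (?r i) = Suc n" "sup_norm (?r i) \<le> int m" "xi al (?r i) \<noteq> 0" if "i \<le> n" for i
      using length_A_mat_nth[OF indep \<open>1 \<le> m\<close>] sup_norm_A_mat_nth[OF indep \<open>1 \<le> m\<close>]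
        xi_A_mat_nth_nonzero[OF indep \<open>1 \<le> m\<close>] that len by auto
    have r_xi: "\<bar>xi al (?r i)\<bar> \<le> C / real m ^ n" if "i \<le> n" for i
      using K(2)[OF m that] \<open>1 \<le> m\<close> by (simp add: field_simps)
    then have "0 \<le> C / real m ^ n" by (meson abs_ge_zero le_refl order_trans)
    have xi_f: "xi al (f k) = (of_int D * \<alpha>) ^ k * xi al (?r n)" for k
      unfolding f_def al_def by (rule xi_mult_step_pow[OF rel]) (use r(1)[of n] in \<open>simp add: al_def\<close>)
    have det: "det (int_mat (Suc n) f) \<noteq> 0"
      using det_mult_step_nonzero[OF indep[unfolded al_def] \<open>D \<noteq> 0\<close> rel, of "?r n"] r[of n]
      by (simp add: f_def al_def)
    \<comment> \<open>This covers \<open>f\<close> itself and every exchange of one of its rows for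
      a row of the matrix. The \<open>n\<close> columns of entries of order \<open>m\<close> and the
      one column of values of order \<open>m ^ (-n)\<close> multiply to a bound free of
      \<open>m\<close>.\<close>
    have bound: "det (int_mat (Suc n) h) \<in> Z"
      if h: "\<And>i. i \<le> n \<Longrightarrow> h i = f i \<or> (\<exists>i'\<le>n. h i = ?r i')" for h
    proof -
      have "\<bar>real_of_int (det (int_mat (Suc n) h))\<bar>
          \<le> fact (Suc n) * ((real E ^ n * real m) ^ n * (H * (C / real m ^ n)))"
      proof (rule abs_det_int_mat_le[of al, unfolded len])
        fix i j assume ij: "i \<le> n" "j \<le> n"
        have "sup_norm (f i) \<le> int (E ^ i * m)"
          unfolding f_def by (rule sup_norm_mult_step_pow) (use E r[of n] in simp_all)
        also have "\<dots> \<le> int (E ^ n * m)"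
          using power_increasing[OF ij(1) \<open>1 \<le> E\<close>] by (metis mult_le_mono1 of_nat_le_iff)
        finally have "sup_norm (f i) \<le> int (E ^ n * m)" .
        moreover have "m \<le> E ^ n * m" using \<open>1 \<le> E\<close> by simp
        then have "sup_norm (?r i') \<le> int (E ^ n * m)" if "i' \<le> n" for i'
          using r(2)[OF that] by linarith
        ultimately have "sup_norm (h i) \<le> int (E ^ n * m)" using h[OF ij(1)] by metis
        moreover have "length (h i) = Suc n" using h[OF ij(1)] r(1) by (auto simp: f_def)
        ultimately have "\<bar>h i ! j\<bar> \<le> int (E ^ n * m)"
          using ij by (intro sup_norm_nth_le) simp_all
        then have "\<bar>real_of_int (h i ! j)\<bar> \<le> real_of_int (int (E ^ n * m))"
          by (metis of_int_abs of_int_le_iff)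
        then show "\<bar>real_of_int (h i ! j)\<bar> \<le> real E ^ n * real m" by simp
      next
        fix i assume i: "i \<le> n"
        have "\<bar>xi al (f i)\<bar> \<le> H * (C / real m ^ n)"
          unfolding xi_f abs_mult[of "_ ^ i"] H_def using i r_xi[of n]
          by (intro mult_mono abs_power_le_power_Suc_abs) auto
        moreover have "1 * (C / real m ^ n) \<le> H * (C / real m ^ n)"
          using \<open>1 \<le> H\<close> \<open>0 \<le> C / real m ^ n\<close> by (rule mult_right_mono)
        then have "\<bar>xi al (?r i')\<bar> \<le> H * (C / real m ^ n)" if "i' \<le> n" for i'
          using r_xi[OF that] by linarith
        ultimately show "\<bar>xi al (h i)\<bar> \<le> H * (C / real m ^ n)" using h[OF i] by metis
      qed
      also have "\<dots> = Q" using \<open>1 \<le> m\<close> by (simp add: Q_def power_mult_distrib)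
      finally show ?thesis by (simp add: Z_def)
    qed
    have "xi al (?r i) / xi al (?r n) \<in> V" if i: "i \<le> n" for i
    proof -
      define g where "g = (\<lambda>k\<in>{..<Suc n}. det (int_mat (Suc n) (f(k := ?r i))))"
      have "of_int (det (int_mat (Suc n) f)) * xi al (?r i)
          = (\<Sum>k<Suc n. of_int (g k) * xi al (f k))"
        using cramer_xi[of al f "?r i"] det r(1)[OF i] len by (simp add: g_def del: sum.lessThan_Suc)
      also have "\<dots> = (\<Sum>k<Suc n. of_int (g k) * (of_int D * \<alpha>) ^ k) * xi al (?r n)"
        by (simp only: xi_f sum_distrib_right mult.assoc)
      finally have "xi al (?r i) / xi al (?r n)
          = (\<Sum>k<Suc n. of_int (g k) * (of_int D * \<alpha>) ^ k) / of_int (det (int_mat (Suc n) f))"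
        using r(3)[of n] det by (simp add: field_simps del: sum.lessThan_Suc)
      moreover have "det (int_mat (Suc n) f) \<in> Z" by (rule bound) simp
      moreover have "g \<in> PiE {..<Suc n} (\<lambda>_. Z)"
        unfolding g_def using i by (intro restrict_PiE_iff[THEN iffD2] ballI bound) auto
      ultimately show ?thesis unfolding V_def
        by (intro image_eqI[of _ _ "(det (int_mat (Suc n) f), g)"]) auto
    qed
    then show ?thesis by (auto simp: in_set_conv_nth act_nth len)
  qed
  \<comment> \<open>The estimates hold only from \<open>K\<close> on; the smaller indices add
    finitely many images.\<close>
  then have "(\<lambda>m. act (A_mat al m) al) ` {1..}
      \<subseteq> (\<lambda>m. act (A_mat al m) al) ` {..<K} \<union> {xs. set xs \<subseteq> V \<and> length xs = n}"
    by (auto simp: not_less[symmetric] simp del: mem_Collect_eq)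
  then show ?thesis
    by (rule finite_subset) (use \<open>finite V\<close> in \<open>simp add: finite_lists_length_eq\<close>)
qed

theorem theorem2:
  fixes n :: nat and \<alpha> :: real
  assumes "n \<ge> 1"
    and "lin_indep_Q (pow_vec n \<alpha>)"
  shows "alg_degree_Q \<alpha> (n + 1) \<longleftrightarrow>
         finite (range (\<lambda>k. act (minkowski_chain (pow_vec n \<alpha>) k) (pow_vec n \<alpha>)))"
proof -
  let ?al = "pow_vec n \<alpha>"
  have len: "length ?al \<ge> 1" using assms(1) by simp
  have chain: "\<exists>m\<ge>1. minkowski_chain ?al k = A_mat ?al m" for k
    using minkowski_chain_eq_A_mat[OF assms(2) len] by metis
  show ?thesis
  proof
    assume "alg_degree_Q \<alpha> (n + 1)"
    then have "finite ((\<lambda>m. act (A_mat ?al m) ?al) ` {1..})"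
      by (rule finite_act_A_mat[OF assms(2)])
    moreover have "range (\<lambda>k. act (minkowski_chain ?al k) ?al) \<subseteq> (\<lambda>m. act (A_mat ?al m) ?al) ` {1..}"
    proof
      fix x assume "x \<in> range (\<lambda>k. act (minkowski_chain ?al k) ?al)"
      then obtain k where "x = act (minkowski_chain ?al k) ?al" by blast
      then show "x \<in> (\<lambda>m. act (A_mat ?al m) ?al) ` {1..}" using chain[of k] by force
    qed
    ultimately show "finite (range (\<lambda>k. act (minkowski_chain ?al k) ?al))"
      by (rule rev_finite_subset)
  next
    assume fin: "finite (range (\<lambda>k. act (minkowski_chain ?al k) ?al))"
    show "alg_degree_Q \<alpha> (n + 1)"
    proof (rule ccontr)
      assume nalg: "\<not> alg_degree_Q \<alpha> (n + 1)"
      \<comment> \<open>The chain is indexed by all natural numbers without repetition, so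
        injectivity of the images along it contradicts their finiteness.\<close>
      have "inj (\<lambda>k. act (minkowski_chain ?al k) ?al)"
      proof (rule injI)
        fix k k' assume eq: "act (minkowski_chain ?al k) ?al = act (minkowski_chain ?al k') ?al"
        obtain m m' where m: "1 \<le> m" "minkowski_chain ?al k = A_mat ?al m"
          "1 \<le> m'" "minkowski_chain ?al k' = A_mat ?al m'" using chain by metis
        then have "minkowski_chain ?al k = minkowski_chain ?al k'"
          using act_A_mat_inj[OF assms(2) nalg m(1,3)] eq by simp
        then show "k = k'" using inj_minkowski_chain[OF assms(2) len] by (simp add: inj_eq)
      qed
      then show False using fin finite_imageD infinite_UNIV_nat by blast
    qed
  qed
qed

end
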